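(* There is an integer $k_0$ such that the following holds for all integers $k\ge k_0$, all integers $q$ with $3\le q<100\ln k$, $n=2k+q$, and every $x\in[n]$. Let $H$, $X$, $d_X$, $T_0$ and $\mathcal G(a,g)$ be as defined in the context. For all integers $a,g\ge 1$ with $a\le T_0$, $$|\mathcal G(a,g)|\le\begin{cases}2^{g/2}, & \text{if } d_X\le g\le d_X^3,\\[2pt] 2^{g\left(1-\frac{1}{k\sqrt{d_X}}\right)}, & \text{if } g>d_X^3.\end{cases}$$
   Context: $[n]=\{1,\dots,n\}$; $\ln$ is the natural logarithm. For $n=2k+q$ and $x\in[n]$, let $X=\binom{[n]\setminus\{x\}}{k+q-1}$ and $Y=\binom{[n]\setminus\{x\}}{k-1}$ (the families of all subsets of $[n]\setminus\{x\}$ of sizes $k+q-1$ and $k-1$). Let $H$ be the bipartite graph with parts $X$ and $Y$ in which $A\in X$ is adjacent to $B\in Y$ if and only if $B\subset A$. Every vertex of $X$ has degree $d_X=\binom{k+q-1}{k-1}$ in $H$. Let $T_0=\binom{n-10}{k+q-1}$. For $\mathcal A\subseteq X$, $N(\mathcal A)\subseteq Y$ is the set of vertices of $H$ adjacent to at least one member of $\mathcal A$, and for $v\in X$, $N(v)=N(\{v\})$. The closure of $\mathcal A$ is $[\mathcal A]=\{v\in X: N(v)\subseteq N(\mathcal A)\}$. A set $\mathcal A\subseteq X$ is 2-linked if for every $u,v\in\mathcal A$ there is a sequence $u=v_1,v_2,\dots,v_\ell=v$ of elements of $\mathcal A$ such that the graph distance in $H$ between $v_i$ and $v_{i+1}$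 is at most $2$ for each $1\le i\le \ell-1$. For integers $a,g\ge1$, $$\mathcal G(a,g)=\{\mathcal A\subseteq X:\ \mathcal A \text{ is 2-linked},\ |[\mathcal A]|=a,\ |N(\mathcal A)|=g\}.$$ *)

theory Defs
  imports "HOL-Analysis.Analysis" "HOL-Library.Extended_Nat"
begin

text \<open>The natural number subtractions below do not truncate in the intended range
  (large \<open>k\<close>, \<open>q \<ge> 3\<close>, \<open>n = 2 * k + q\<close>).\<close>

definition X_part :: "nat \<Rightarrow> nat \<Rightarrow> nat \<Rightarrow> nat \<Rightarrow> nat set set" where
  "X_part n k q x = {A. A \<subseteq> {1..n} - {x} \<and> card A = k + q - 1}"

definition Y_part :: "nat \<Rightarrow> nat \<Rightarrow> nat \<Rightarrow> nat set set" where
  "Y_part n k x = {B. B \<subseteq> {1..n} - {x} \<and> card B = k - 1}"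

text \<open>The parts are disjoint as sets of sets when \<open>q \<ge> 1\<close> and \<open>k \<ge> 1\<close>, so no tagging is needed
  to form the vertex set. The edge relation contains both orientations of every edge.\<close>

definition H_edges :: "nat \<Rightarrow> nat \<Rightarrow> nat \<Rightarrow> nat \<Rightarrow> (nat set \<times> nat set) set" where
  "H_edges n k q x =
     {(A, B). A \<in> X_part n k q x \<and> B \<in> Y_part n k x \<and> B \<subseteq> A} \<union>
     {(B, A). A \<in> X_part n k q x \<and> B \<in> Y_part n k x \<and> B \<subseteq> A}"

text \<open>Pairs in \<open>E ^^ l\<close> are joined by a walk of length \<open>l\<close>; the infimum is \<open>\<infinity>\<close> if
  there is no walk.\<close>

definition graph_dist :: "('a \<times> 'a) set \<Rightarrow> 'a \<Rightarrow> 'a \<Rightarrow> enat" where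
  "graph_dist E u v = (INF l \<in> {l. (u, v) \<in> E ^^ l}. enat l)"

definition d_X :: "nat \<Rightarrow> nat \<Rightarrow> nat" where
  "d_X k q = (k + q - 1) choose (k - 1)"

definition T0 :: "nat \<Rightarrow> nat \<Rightarrow> nat \<Rightarrow> nat" where
  "T0 n k q = (n - 10) choose (k + q - 1)"

definition nbhd :: "nat \<Rightarrow> nat \<Rightarrow> nat \<Rightarrow> nat \<Rightarrow> nat set set \<Rightarrow> nat set set" where
  "nbhd n k q x \<A> = {B \<in> Y_part n k x. \<exists>A\<in>\<A>. (A, B) \<in> H_edges n k q x}"

definition closure_X :: "nat \<Rightarrow> nat \<Rightarrow> nat \<Rightarrow> nat \<Rightarrow> nat set set \<Rightarrow> nat set set" where
  "closure_X n k q x \<A> = {v \<in> X_part n k q x. nbhd n k q x {v} \<subseteq> nbhd n k q x \<A>}"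

definition two_linked :: "nat \<Rightarrow> nat \<Rightarrow> nat \<Rightarrow> nat \<Rightarrow> nat set set \<Rightarrow> bool" where
  "two_linked n k q x \<A> \<longleftrightarrow>
     (\<forall>u\<in>\<A>. \<forall>v\<in>\<A>. \<exists>vs. vs \<noteq> [] \<and> hd vs = u \<and> last vs = v \<and> set vs \<subseteq> \<A> \<and>
        (\<forall>i. Suc i < length vs \<longrightarrow> graph_dist (H_edges n k q x) (vs ! i) (vs ! Suc i) \<le> 2))"

definition G_family :: "nat \<Rightarrow> nat \<Rightarrow> nat \<Rightarrow> nat \<Rightarrow> nat \<Rightarrow> nat \<Rightarrow> nat set set set" where
  "G_family n k q x a g =
     {\<A>. \<A> \<subseteq> X_part n k q x \<and> two_linked n k q x \<A> \<and>
          card (closure_X n k q x \<A>) = a \<and> card (nbhd n k q x \<A>) = g}"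

end

theory Submission
  imports Defs "HOL-Real_Asymp.Real_Asymp"
begin

text \<open>Write \<open>N = n - 1\<close> and \<open>\<rho> = q / k\<close>, so \<open>|X| = (1 + \<rho>) |Y|\<close>.

  If \<open>g \<le> d\<^sub>X\<^sup>3\<close>, then Kruskal--Katona forces \<open>a \<le> g / (12 k)\<close>, and at most about \<open>2\<^sup>n\<^sup>a\<close> sets have size
  at most \<open>a\<close>. If \<open>g > |Y| / 40\<close>, then the number of all subsets of \<open>X\<close> of size at most
  \<open>a \<le> T\<^sub>0 \<le> |X| / 512\<close> is small enough.

  Otherwise a container argument applies. Choosing greedily members of a set \<open>A\<close> that contribute more
  than \<open>\<psi> = k\<^sup>3\<^sup>/\<^sup>2\<close> new neighbours gives \<open>T \<subseteq> A\<close> with \<open>|T| \<le> g / \<psi>\<close> such that \<open>A\<close> lies in the set \<open>S\<close>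
  of all \<open>u\<close> with at most \<open>\<psi>\<close> neighbours outside \<open>N(T)\<close>. A robust form of Kruskal--Katona
  yields \<open>|S| \<le> |N(T)| / (1 + \<rho>/4) \<le> g (1 - 1/(2k))\<close>, so \<open>T\<close> leaves at most \<open>2\<^bsup>g(1 - 1/(2k))\<^esup>\<close>
  choices for \<open>A\<close>. To name \<open>T\<close> cheaply, first run the same greedy choice with threshold \<open>d\<^sub>X / 2\<close>:
  its result confines \<open>T\<close> to a set of size \<open>3 g\<close>, so that each element of \<open>T\<close> costs only about
  \<open>2 log k\<close> bits, and \<open>log k / \<psi>\<close> is much smaller than \<open>1/k\<close>.\<close>

section \<open>The Kruskal--Katona theorem\<close>

lemma card_between_sets:
  assumes "finite U" "B \<subseteq> U" "card B \<le> l"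
  shows "card {D. B \<subseteq> D \<and> D \<subseteq> U \<and> card D = l} = (card U - card B) choose (l - card B)"
proof -
  have fB: "finite B" using assms finite_subset by blast
  have "bij_betw (\<lambda>E. E \<union> B) {E. E \<subseteq> U - B \<and> card E = l - card B}
          {D. B \<subseteq> D \<and> D \<subseteq> U \<and> card D = l}"
  proof (rule bij_betwI[where g = "\<lambda>D. D - B"])
    show "(\<lambda>E. E \<union> B) \<in> {E. E \<subseteq> U - B \<and> card E = l - card B} \<rightarrow> {D. B \<subseteq> D \<and> D \<subseteq> U \<and> card D = l}"
    proof
      fix E assume E: "E \<in> {E. E \<subseteq> U - B \<and> card E = l - card B}"
      then have "finite E" using assms(1) by (auto intro: finite_subset)
      moreover have "E \<inter> B = {}" using E by auto
      ultimately have "card (E \<union> B) = card E + card B" using fB by (intro card_Un_disjoint)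
      then show "E \<union> B \<in> {D. B \<subseteq> D \<and> D \<subseteq> U \<and> card D = l}" using E assms by auto
    qed
    show "(\<lambda>D. D - B) \<in> {D. B \<subseteq> D \<and> D \<subseteq> U \<and> card D = l} \<rightarrow> {E. E \<subseteq> U - B \<and> card E = l - card B}"
      using fB by (auto simp: card_Diff_subset)
  qed auto
  then have "card {D. B \<subseteq> D \<and> D \<subseteq> U \<and> card D = l} = card {E. E \<subseteq> U - B \<and> card E = l - card B}"
    by (simp add: bij_betw_same_card)
  also have "\<dots> = card (U - B) choose (l - card B)"
    using assms by (intro n_subsets) auto
  also have "card (U - B) = card U - card B"
    using fB assms by (simp add: card_Diff_subset)
  finally show ?thesis .
qed

lemma sum_card_filter_swap:
  assumes "finite A" "finite B"
  shows "(\<Sum>x\<in>A. card {y\<in>B. R x y}) = (\<Sum>y\<in>B. card {x\<in>A. R x y})"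
proof -
  have "(\<Sum>x\<in>A. card {y\<in>B. R x y}) = (\<Sum>x\<in>A. \<Sum>y\<in>B. if R x y then 1 else 0)"
    using assms by (simp add: sum.If_cases Int_def)
  also have "\<dots> = (\<Sum>y\<in>B. \<Sum>x\<in>A. if R x y then 1 else 0)"
    by (rule sum.swap)
  also have "\<dots> = (\<Sum>y\<in>B. card {x\<in>A. R x y})"
    using assms by (simp add: sum.If_cases Int_def)
  finally show ?thesis .
qed

lemma sum_degrees:
  assumes "finite V" "\<And>D. D \<in> G \<Longrightarrow> D \<subseteq> V \<and> card D = r"
  shows "(\<Sum>v\<in>V. card {D\<in>G. v \<in> D}) = r * card G"
proof -
  have fG: "finite G" using assms by (intro finite_subset[of G "Pow V"]) auto
  have "(\<Sum>v\<in>V. card {D\<in>G. v \<in> D}) = (\<Sum>D\<in>G. card {v\<in>V. v \<in> D})"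
    using assms(1) fG by (rule sum_card_filter_swap)
  also have "\<dots> = (\<Sum>D\<in>G. r)"
  proof (rule sum.cong)
    fix D assume "D \<in> G"
    then have "{v\<in>V. v \<in> D} = D" using assms(2) by auto
    then show "card {v\<in>V. v \<in> D} = r" using assms(2) \<open>D \<in> G\<close> by simp
  qed simp
  finally show ?thesis by simp
qed

text \<open>Keevash's proof of the Lovasz form: by induction on links, the number of members of \<open>U\<close> through a vertex
  \<open>v\<close> is at most \<open>(m - r) / r\<close> times the degree of \<open>v\<close>. If the degree is large, this holds because
  removing \<open>v\<close> maps these members injectively to the members of \<open>G\<close> avoiding \<open>v\<close>.\<close>

lemma kruskal_katona_step:
  assumes "finite V" "r \<ge> 1"
    and "\<And>D. D \<in> G \<Longrightarrow> D \<subseteq> V \<and> card D = r"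
    and "\<And>u. u \<in> U \<Longrightarrow> u \<subseteq> V \<and> card u = Suc r"
    and "\<And>u v. u \<in> U \<Longrightarrow> v \<in> u \<Longrightarrow> u - {v} \<in> G"
    and "card G \<le> m choose r"
  shows "Suc r * card U \<le> (m - r) * card G"
  using assms(2-)
proof (induction r arbitrary: G U m rule: less_induct)
  case (less r)
  note r1 = less.prems(1) and G = less.prems(2) and U = less.prems(3)
    and sub = less.prems(4) and cG = less.prems(5)
  have fG: "finite G" using G assms(1) by (intro finite_subset[of G "Pow V"]) auto
  have fU: "finite U" using U assms(1) by (intro finite_subset[of U "Pow V"]) auto
  show ?case
  proof (cases "r \<le> m")
    \<comment> \<open>For \<open>m < r\<close> the subtraction \<open>m - r\<close> truncates to
      \<open>0\<close>, so \<open>U\<close> has to be empty; it is, because \<open>G\<close>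
      is.\<close>
    case False
    then have "G = {}" using cG fG by (simp add: binomial_eq_0)
    have "U = {}"
    proof (rule ccontr)
      assume "U \<noteq> {}"
      then obtain u where u: "u \<in> U" by auto
      then have "u \<noteq> {}" using U[OF u] by auto
      then show False using sub[OF u] \<open>G = {}\<close> by auto
    qed
    then show ?thesis by simp
  next
    case True
    have key: "r * card {u\<in>U. v \<in> u} \<le> (m - r) * card {D\<in>G. v \<in> D}" for v
    proof -
      define Gv where "Gv = (\<lambda>D. D - {v}) ` {D\<in>G. v \<in> D}"
      define Uv where "Uv = (\<lambda>D. D - {v}) ` {D\<in>U. v \<in> D}"
      have inj: "inj_on (\<lambda>D. D - {v}) {D\<in>W. v \<in> D}" for W :: "'a set set"
        by (rule inj_onI) blast
      have cGv: "card Gv = card {D\<in>G. v \<in> D}" unfolding Gv_def by (intro card_image inj)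
      have cUv: "card Uv = card {u\<in>U. v \<in> u}" unfolding Uv_def by (intro card_image inj)
      have fGv: "finite Gv" unfolding Gv_def using fG by auto
      show ?thesis
      proof (cases "card Gv < (m - 1) choose (r - 1)")
        case False
        \<comment> \<open>Large degree: absorption turns the bounds on \<open>card Gv\<close> and
          \<open>card G\<close> into \<open>r * card G \<le> m * card Gv\<close>, which limits the
          members of \<open>G\<close> that avoid \<open>v\<close>.\<close>
        have "m * ((m - 1) choose (r - 1)) = r * (m choose r)"
          using r1 True by (metis One_nat_def Suc_pred binomial_absorption le_trans less_eq_Suc_le mult.commute diff_Suc_1)
        then have 1: "r * card G \<le> m * card Gv"
          using False cG by (metis linorder_not_less mult_le_mono2 order_trans)
        have "Uv \<subseteq> {D\<in>G. v \<notin> D}" unfolding Uv_def using sub by auto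
        then have "card Uv \<le> card {D\<in>G. v \<notin> D}" using fG by (intro card_mono) auto
        also have "{D\<in>G. v \<notin> D} = G - {D\<in>G. v \<in> D}" by auto
        also have "card (G - {D\<in>G. v \<in> D}) = card G - card Gv"
          unfolding cGv using fG by (intro card_Diff_subset) auto
        finally have "r * card Uv \<le> r * card G - r * card Gv"
          by (metis diff_mult_distrib2 mult_le_mono2)
        also have "\<dots> \<le> (m - r) * card Gv" using 1 by (simp add: diff_mult_distrib)
        finally show ?thesis unfolding cGv cUv .
      next
        case cGv_less: True
        show ?thesis
        proof (cases "r = 1")
          \<comment> \<open>Base of the induction: the threshold is
            \<open>(m - 1) choose 0 = 1\<close>, so \<open>{v}\<close> is not in \<open>G\<close>,
            whereas a member \<open>{v, w}\<close> of \<open>U\<close> would put it there by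
            deleting \<open>w\<close>.\<close>
          case r: True
          then have "Gv = {}" using cGv_less fGv by simp
          have "{u\<in>U. v \<in> u} = {}"
          proof (rule ccontr)
            assume "{u\<in>U. v \<in> u} \<noteq> {}"
            then obtain u where u: "u \<in> U" "v \<in> u" by auto
            then have "card (u - {v}) = 1" using U[OF u(1)] r by (simp add: card.insert_remove)
            then obtain w where w: "w \<in> u" "w \<noteq> v"
              by (metis card_1_singletonE insertCI insert_Diff_single Diff_iff singletonI)
            then have "u - {w} \<in> {D\<in>G. v \<in> D}" using sub[OF u(1) w(1)] u by auto
            then show False using \<open>Gv = {}\<close> unfolding Gv_def by blast
          qed
          then have "card {u\<in>U. v \<in> u} = 0" by (simp only: card.empty)
          then show ?thesis by simp
        next
          case r: False
          \<comment> \<open>Small degree: the links at \<open>v\<close> satisfy the hypotheses with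
            \<open>r\<close> and \<open>m\<close> both lowered by one, and \<open>m - r\<close> is
            unchanged.\<close>
          have "Suc (r - 1) * card Uv \<le> ((m - 1) - (r - 1)) * card Gv"
          proof (rule less.IH)
            show "r - 1 < r" "1 \<le> r - 1" using r r1 by auto
            show "D \<subseteq> V \<and> card D = r - 1" if "D \<in> Gv" for D
              using that G assms(1) unfolding Gv_def by (auto intro: finite_subset)
            show "D \<subseteq> V \<and> card D = Suc (r - 1)" if "D \<in> Uv" for D
              using that U assms(1) r1 unfolding Uv_def by (auto intro: finite_subset)
            show "u - {w} \<in> Gv" if uw: "u \<in> Uv" "w \<in> u" for u w
            proof -
              obtain u' where u': "u' \<in> U" "v \<in> u'" "u = u' - {v}"
                using uw(1) unfolding Uv_def by blast
              then have "u' - {w} \<in> {D\<in>G. v \<in> D}" using sub[OF u'(1)] uw(2) by auto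
              moreover have "u - {w} = (u' - {w}) - {v}" using u' by auto
              ultimately show ?thesis unfolding Gv_def by blast
            qed
            show "card Gv \<le> (m - 1) choose (r - 1)" using cGv_less by simp
          qed
          then show ?thesis using r1 unfolding cGv cUv by simp
        qed
      qed
    qed
    \<comment> \<open>Summing over \<open>v\<close> counts each member of \<open>U\<close>
      \<open>Suc r\<close> times and each member of \<open>G\<close> \<open>r\<close> times; the
      common factor \<open>r\<close> cancels.\<close>
    have "r * (Suc r * card U) = (\<Sum>v\<in>V. r * card {u\<in>U. v \<in> u})"
      using sum_degrees[OF assms(1), of U "Suc r"] U by (simp flip: sum_distrib_left)
    also have "\<dots> \<le> (\<Sum>v\<in>V. (m - r) * card {D\<in>G. v \<in> D})"
      by (intro sum_mono key)
    also have "\<dots> = r * ((m - r) * card G)"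
      using sum_degrees[OF assms(1), of G r] G by (simp flip: sum_distrib_left)
    finally show ?thesis using r1 by simp
  qed
qed

text \<open>The target level \<open>l\<close> is free, so this is an iterated shadow; for families
  in \<open>X\<close> the shadow at level \<open>k - 1\<close> is the neighbourhood in
  \<open>H\<close>.\<close>

definition shadow :: "nat \<Rightarrow> 'a set set \<Rightarrow> 'a set set" where
  "shadow l S = {D. card D = l \<and> (\<exists>u\<in>S. D \<subseteq> u)}"

text \<open>Induction on \<open>s\<close>, passing to the shadow one level down. The bound on the
  lowest shadow is inherited by that shadow, and the induction hypothesis turns it into
  \<open>card S' \<le> m choose s\<close>, which the one-level step needs.\<close>

lemma kruskal_katona_levels:
  assumes "finite V" "r \<ge> 1" "r \<le> s"
    and "\<And>u. u \<in> S \<Longrightarrow> u \<subseteq> V \<and> card u = s"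
    and "card (shadow r S) \<le> m choose r"
  shows "card S * (m choose r) \<le> card (shadow r S) * (m choose s)"
  using assms(3-)
proof (induction s arbitrary: S rule: dec_induct)
  case base
  have "shadow r S = S"
  proof
    show "S \<subseteq> shadow r S" using base by (auto simp: shadow_def)
    show "shadow r S \<subseteq> S"
    proof
      fix D assume "D \<in> shadow r S"
      then obtain u where u: "u \<in> S" "D \<subseteq> u" "card D = r" by (auto simp: shadow_def)
      then have "D = u" using base assms(1) by (metis card_subset_eq finite_subset)
      then show "D \<in> S" using u by simp
    qed
  qed
  then show ?case by simp
next
  case (step s)
  define S' where "S' = shadow s S"
  have S': "u \<subseteq> V \<and> card u = s" if "u \<in> S'" for u
    using that step.prems(1) by (auto simp: S'_def shadow_def)
  have fin: "finite V'" if "\<And>u. u \<in> V' \<Longrightarrow> u \<subseteq> V" for V' 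
    using assms(1) that by (intro finite_subset[of V' "Pow V"]) auto
  have sh: "shadow r S' \<subseteq> shadow r S" unfolding S'_def shadow_def by blast
  have fsh: "finite (shadow r S)" using step.prems(1) by (intro fin) (auto simp: shadow_def)
  have csh: "card (shadow r S') \<le> card (shadow r S)" using sh fsh by (rule card_mono[rotated])
  have "card S' * (m choose r) \<le> card (shadow r S') * (m choose s)"
    using S' csh step.prems(2) by (intro step.IH) auto
  also have "\<dots> \<le> card (shadow r S) * (m choose s)" using csh by simp
  finally have 1: "card S' * (m choose r) \<le> card (shadow r S) * (m choose s)" .
  show ?case
  proof (cases "m choose r = 0")
    case True
    show ?thesis unfolding True by simp
  next
    case False
    have "card S' * (m choose r) \<le> (m choose r) * (m choose s)"
      using 1 step.prems(2) by (meson le_trans mult_le_mono1)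
    then have c': "card S' \<le> m choose s" using False by simp
    have "Suc s * card S \<le> (m - s) * card S'"
    proof (rule kruskal_katona_step)
      show "finite V" "1 \<le> s" using assms step by auto
      show "u - {v} \<in> S'" if "u \<in> S" "v \<in> u" for u v
        using that step.prems(1)[of u] assms(1) by (auto simp: S'_def shadow_def intro: finite_subset)
    qed (use S' step.prems c' in auto)
    then have "Suc s * (card S * (m choose r)) \<le> (m - s) * (card S' * (m choose r))"
      by (metis mult.assoc mult_le_mono1)
    also have "\<dots> \<le> (m - s) * (card (shadow r S) * (m choose s))" using 1 by simp
    also have "\<dots> = card (shadow r S) * ((m - s) * (m choose s))" by simp
    also have "(m - s) * (m choose s) = Suc s * (m choose Suc s)"
      by (simp only: binomial_absorb_comp binomial_absorption)
    finally have "Suc s * (card S * (m choose r)) \<le> Suc s * (card (shadow r S) * (m choose Suc s))"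
      by (simp only: mult.left_commute)
    then show ?thesis by (metis Suc_mult_le_cancel1)
  qed
qed

text \<open>Here the size of the family is bounded rather than that of its shadow. If the shadow
  exceeds \<open>m choose r\<close>, the inequality is just the product of two size bounds.\<close>

lemma kruskal_katona_shadow:
  assumes "finite V" "r \<ge> 1" "r \<le> s"
    and "\<And>u. u \<in> S \<Longrightarrow> u \<subseteq> V \<and> card u = s"
    and "card S \<le> m choose s"
  shows "card S * (m choose r) \<le> card (shadow r S) * (m choose s)"
proof (cases "card (shadow r S) \<le> m choose r")
  case True
  then show ?thesis using assms by (intro kruskal_katona_levels)
next
  case False
  then show ?thesis using assms(5) by (metis linear mult.commute mult_le_mono)
qed

section \<open>Robust expansion\<close>

text \<open>If each \<open>u \<in> S\<close> misses at most \<open>\<psi>\<close> members of \<open>F\<close>, the total number of misses over the level-\<open>l\<close>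
  shadow is controlled by summing \<open>(\<Delta> - deg D) (\<psi> - miss D) \<ge> 0\<close>, where \<open>\<Delta>\<close> is the maximal degree.
  The outcome interpolates between the Kruskal--Katona gain and the plain degree count.\<close>

lemma robust_shadow:
  fixes \<psi> :: real
  assumes V: "finite V" "card V = N" and le: "r \<le> l" "l \<le> s" "s \<le> N"
    and S: "\<And>u. u \<in> S \<Longrightarrow> u \<subseteq> V \<and> card u = s"
    and F: "\<And>B. B \<in> F \<Longrightarrow> B \<subseteq> V \<and> card B = r"
    and miss: "\<And>u. u \<in> S \<Longrightarrow> real (card {B. B \<subseteq> u \<and> card B = r \<and> B \<notin> F}) \<le> \<psi>"
  shows "(1 - \<psi> / real (l choose r)) * real (card (shadow l S))
      + (\<psi> / real (l choose r) - \<psi> / real (s choose r))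
          * (real (N choose l) / real (N choose s)) * real (card S)
      \<le> real (N choose l) / real (N choose r) * real (card F)"
proof -
  define Sh where "Sh = shadow l S"
  define mi where "mi D = real (card {B. B \<subseteq> D \<and> card B = r \<and> B \<notin> F})" for D
  define deg where "deg D = real (card {u\<in>S. D \<subseteq> u})" for D
  define \<Delta> where "\<Delta> = real ((N - l) choose (s - l))"
  define c where "c = real (l choose r)"
  define e where "e = real ((N - r) choose (l - r))"
  define h where "h = real ((s - r) choose (l - r))"
  have fin: "finite W" if "\<And>u. u \<in> W \<Longrightarrow> u \<subseteq> V" for W
    using V(1) that by (intro finite_subset[of W "Pow V"]) auto
  have fS: "finite S" using S by (intro fin) auto
  have fF: "finite F" using F by (intro fin) auto
  have Sh: "D \<subseteq> V \<and> card D = l \<and> finite D" if "D \<in> Sh" for D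
  proof -
    from that obtain u where "u \<in> S" "D \<subseteq> u" "card D = l" by (auto simp: Sh_def shadow_def)
    then have "D \<subseteq> V" "card D = l" using S by auto
    then show ?thesis using V(1) finite_subset by blast
  qed
  have fSh: "finite Sh" using Sh by (intro fin) auto
  have pos: "\<Delta> > 0" "c > 0" "e > 0" using le by (auto simp: \<Delta>_def c_def e_def)

  \<comment> \<open>Containments \<open>B \<subseteq> D\<close> with \<open>B\<close> in
    \<open>F\<close> are counted in two ways: \<open>D\<close> contains \<open>c - mi D\<close> such
    \<open>B\<close>, and each \<open>B\<close> lies in at most \<open>e\<close> sets of level
    \<open>l\<close>.\<close>
  have "(\<Sum>D\<in>Sh. c - mi D) \<le> e * real (card F)"
  proof -
    have "c - mi D = real (card {B\<in>F. B \<subseteq> D})" if "D \<in> Sh" for D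
    proof -
      have fD: "finite {B. B \<subseteq> D \<and> card B = r}" using Sh[OF that] by auto
      have "c = real (card {B. B \<subseteq> D \<and> card B = r})"
        using Sh[OF that] by (simp add: c_def n_subsets)
      also have "{B. B \<subseteq> D \<and> card B = r} = {B\<in>F. B \<subseteq> D} \<union> {B. B \<subseteq> D \<and> card B = r \<and> B \<notin> F}"
        using F by auto
      also have "card \<dots> = card {B\<in>F. B \<subseteq> D} + card {B. B \<subseteq> D \<and> card B = r \<and> B \<notin> F}"
        using fF by (intro card_Un_disjoint) (auto intro: finite_subset[OF _ fD])
      finally show ?thesis by (simp add: mi_def)
    qed
    then have "(\<Sum>D\<in>Sh. c - mi D) = real (\<Sum>D\<in>Sh. card {B\<in>F. B \<subseteq> D})" by simp
    also have "(\<Sum>D\<in>Sh. card {B\<in>F. B \<subseteq> D}) = (\<Sum>B\<in>F. card {D\<in>Sh. B \<subseteq> D})"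
      using fSh fF by (rule sum_card_filter_swap)
    also have "\<dots> \<le> (\<Sum>B\<in>F. (N - r) choose (l - r))"
    proof (rule sum_mono)
      fix B assume B: "B \<in> F"
      have "card {D\<in>Sh. B \<subseteq> D} \<le> card {D. B \<subseteq> D \<and> D \<subseteq> V \<and> card D = l}"
        using V(1) Sh by (intro card_mono) auto
      also have "\<dots> = (N - r) choose (l - r)"
        using card_between_sets[of V B l] F[OF B] V le by simp
      finally show "card {D\<in>Sh. B \<subseteq> D} \<le> (N - r) choose (l - r)" .
    qed
    finally show ?thesis by (simp add: e_def mult.commute)
  qed
  then have 1: "c * real (card Sh) - (\<Sum>D\<in>Sh. mi D) \<le> e * real (card F)"
    by (simp add: sum_subtractf mult.commute)

  have mi_le: "mi D \<le> \<psi>" if D: "D \<in> Sh" for D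
  proof -
    from D obtain u where u: "u \<in> S" "D \<subseteq> u" by (auto simp: Sh_def shadow_def)
    have "finite u" using S[OF u(1)] V(1) finite_subset by blast
    then have "mi D \<le> real (card {B. B \<subseteq> u \<and> card B = r \<and> B \<notin> F})"
      unfolding mi_def using u(2) by (intro of_nat_mono card_mono) auto
    then show ?thesis using miss[OF u(1)] by simp
  qed
  have deg_le: "deg D \<le> \<Delta>" if D: "D \<in> Sh" for D
  proof -
    have "card {u\<in>S. D \<subseteq> u} \<le> card {u. D \<subseteq> u \<and> u \<subseteq> V \<and> card u = s}"
      using V(1) S by (intro card_mono) auto
    also have "\<dots> = (N - l) choose (s - l)"
      using card_between_sets[of V D s] Sh[OF D] V le by simp
    finally show ?thesis by (simp add: deg_def \<Delta>_def)
  qed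
  have sum_swap: "(\<Sum>D\<in>Sh. deg D * f D) = (\<Sum>u\<in>S. \<Sum>D | D \<subseteq> u \<and> card D = l. f D)"
    for f :: "'a set \<Rightarrow> real"
  proof -
    have "(\<Sum>D\<in>Sh. deg D * f D) = (\<Sum>D\<in>Sh. \<Sum>u | u \<in> S \<and> D \<subseteq> u. f D)"
      by (simp add: deg_def)
    also have "\<dots> = (\<Sum>u\<in>S. \<Sum>D | D \<in> Sh \<and> D \<subseteq> u. f D)"
      using fSh fS by (rule sum.swap_restrict)
    also have "\<dots> = (\<Sum>u\<in>S. \<Sum>D | D \<subseteq> u \<and> card D = l. f D)"
      by (intro sum.cong refl) (auto simp: Sh_def shadow_def)
    finally show ?thesis .
  qed
  have sum_deg: "(\<Sum>D\<in>Sh. deg D) = real (s choose l) * real (card S)"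
  proof -
    have "(\<Sum>D\<in>Sh. deg D) = (\<Sum>u\<in>S. real (card {D. D \<subseteq> u \<and> card D = l}))"
      using sum_swap[of "\<lambda>_. 1"] by simp
    also have "\<dots> = (\<Sum>u\<in>S. real (s choose l))"
    proof (rule sum.cong)
      fix u assume "u \<in> S"
      then have "card {D. D \<subseteq> u \<and> card D = l} = s choose l"
        using S[of u] V(1) n_subsets[of u l] finite_subset by metis
      then show "real (card {D. D \<subseteq> u \<and> card D = l}) = real (s choose l)" by simp
    qed simp
    finally show ?thesis by simp
  qed
  \<comment> \<open>The weight \<open>deg D\<close> moves the sum from \<open>D\<close> to the
    members \<open>u\<close> of \<open>S\<close>, where the hypothesis \<open>miss\<close> applies:
    each missed \<open>B\<close> below \<open>u\<close> is counted for exactly \<open>h\<close> sets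
    \<open>D\<close>.\<close>
  have "(\<Sum>D\<in>Sh. deg D * mi D) \<le> (\<Sum>u\<in>S. \<psi> * h)"
    unfolding sum_swap
  proof (rule sum_mono)
    fix u assume u: "u \<in> S"
    have fu: "finite u" using S[OF u] V(1) finite_subset by blast
    define Bad where "Bad = {B. B \<subseteq> u \<and> card B = r \<and> B \<notin> F}"
    have fBad: "finite Bad" unfolding Bad_def using fu by auto
    have "mi D = real (card {B\<in>Bad. B \<subseteq> D})" if "D \<subseteq> u" for D
      unfolding mi_def Bad_def using that by (intro arg_cong[where f = "\<lambda>A. real (card A)"]) auto
    then have "(\<Sum>D | D \<subseteq> u \<and> card D = l. mi D)
        = real (\<Sum>D | D \<subseteq> u \<and> card D = l. card {B\<in>Bad. B \<subseteq> D})" by simp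
    also have "(\<Sum>D | D \<subseteq> u \<and> card D = l. card {B\<in>Bad. B \<subseteq> D})
        = (\<Sum>B\<in>Bad. card {D \<in> {D. D \<subseteq> u \<and> card D = l}. B \<subseteq> D})"
      using fu fBad by (intro sum_card_filter_swap) auto
    also have "\<dots> = (\<Sum>B\<in>Bad. (s - r) choose (l - r))"
    proof (rule sum.cong)
      fix B assume "B \<in> Bad"
      then have "card {D. B \<subseteq> D \<and> D \<subseteq> u \<and> card D = l} = (s - r) choose (l - r)"
        using card_between_sets[of u B l] S[OF u] fu le by (auto simp: Bad_def)
      then show "card {D \<in> {D. D \<subseteq> u \<and> card D = l}. B \<subseteq> D} = (s - r) choose (l - r)"
        by (simp add: conj_ac)
    qed simp
    finally have "(\<Sum>D | D \<subseteq> u \<and> card D = l. mi D) = real (card Bad) * h" by (simp add: h_def)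
    then show "(\<Sum>D | D \<subseteq> u \<and> card D = l. mi D) \<le> \<psi> * h"
      using miss[OF u] by (simp add: Bad_def h_def mult_right_mono)
  qed
  then have 3: "(\<Sum>D\<in>Sh. deg D * mi D) \<le> \<psi> * h * real (card S)" by (simp add: mult.commute)

  \<comment> \<open>Expanding the product bounds the unweighted sum of \<open>mi D\<close> by
    \<open>card Sh\<close> and the two degree-weighted sums, which are already under
    control.\<close>
  have "0 \<le> (\<Sum>D\<in>Sh. (\<Delta> - deg D) * (\<psi> - mi D))"
    using mi_le deg_le by (intro sum_nonneg mult_nonneg_nonneg) auto
  also have "\<dots> = \<Delta> * \<psi> * real (card Sh) - \<Delta> * (\<Sum>D\<in>Sh. mi D) - \<psi> * (\<Sum>D\<in>Sh. deg D)
      + (\<Sum>D\<in>Sh. deg D * mi D)"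
    by (simp add: algebra_simps sum.distrib sum_subtractf sum_distrib_left)
  finally have "\<Delta> * (\<Sum>D\<in>Sh. mi D) \<le> \<Delta> * \<psi> * real (card Sh)
      - \<psi> * (real (s choose l) * real (card S)) + \<psi> * h * real (card S)"
    using 3 sum_deg by simp
  then have "(\<Sum>D\<in>Sh. mi D) \<le> \<psi> * real (card Sh)
      - \<psi> * (real (s choose l) / \<Delta> * real (card S)) + \<psi> * (h / \<Delta>) * real (card S)"
    using pos by (simp add: field_simps)
  with 1 have 4: "(c - \<psi>) * real (card Sh) + \<psi> * (real (s choose l) / \<Delta> * real (card S))
      - \<psi> * (h / \<Delta>) * real (card S) \<le> e * real (card F)"
    by (simp add: algebra_simps)

  \<comment> \<open>Trinomial revision, \<open>choose_mult\<close>, rewrites \<open>e\<close>,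
    \<open>\<Delta>\<close> and \<open>h\<close> through ratios of binomials; the common factor
    \<open>c\<close> is divided out at the end.\<close>
  have e: "e = c * (real (N choose l) / real (N choose r))"
  proof -
    have "(N choose l) * (l choose r) = (N choose r) * ((N - r) choose (l - r))"
      using le by (intro choose_mult) auto
    then have "real (N choose l) * c = real (N choose r) * e"
      unfolding c_def e_def by (metis of_nat_mult)
    then show ?thesis using le by (simp add: field_simps)
  qed
  have sl: "real (s choose l) / \<Delta> = real (N choose l) / real (N choose s)"
  proof -
    have "(N choose s) * (s choose l) = (N choose l) * ((N - l) choose (s - l))"
      using le by (intro choose_mult) auto
    then have "real (N choose s) * real (s choose l) = real (N choose l) * \<Delta>"
      unfolding \<Delta>_def by (metis of_nat_mult)
    then show ?thesis using le pos by (simp add: field_simps)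
  qed
  have h: "h = c * (real (s choose l) / real (s choose r))"
  proof -
    have "(s choose l) * (l choose r) = (s choose r) * ((s - r) choose (l - r))"
      using le by (intro choose_mult) auto
    then have "real (s choose l) * c = real (s choose r) * h"
      unfolding c_def h_def by (metis of_nat_mult)
    then show ?thesis using le by (simp add: field_simps)
  qed
  have hd: "h / \<Delta> = c * (1 / real (s choose r)) * (real (N choose l) / real (N choose s))"
    unfolding h sl[symmetric] by simp
  have x: "c * (1 - \<psi> / c) = c - \<psi>" "c * (\<psi> / c - \<psi> / real (s choose r)) = \<psi> - c * (\<psi> / real (s choose r))"
    using pos by (simp_all add: field_simps)
  have "c * ((1 - \<psi> / c) * real (card Sh)
      + (\<psi> / c - \<psi> / real (s choose r)) * (real (N choose l) / real (N choose s)) * real (card S))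
      = (c * (1 - \<psi> / c)) * real (card Sh)
      + (c * (\<psi> / c - \<psi> / real (s choose r))) * (real (N choose l) / real (N choose s)) * real (card S)"
    by (simp only: distrib_left mult.assoc)
  also have "\<dots> = (c - \<psi>) * real (card Sh) + \<psi> * (real (s choose l) / \<Delta> * real (card S))
      - \<psi> * (h / \<Delta>) * real (card S)"
    unfolding hd sl x by (simp add: algebra_simps)
  also have "\<dots> \<le> c * (real (N choose l) / real (N choose r) * real (card F))"
    using 4 unfolding e by (simp add: mult.assoc)
  finally show ?thesis unfolding mult_le_cancel_left_pos[OF pos(2)] by (simp add: c_def Sh_def)
qed

lemma binomial_pred_top:
  assumes "M \<ge> 1"
  shows "real ((M - 1) choose j) = real (M choose j) * ((real M - real j) / real M)"
proof (cases "j \<le> M")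
  case True
  have "M * ((M - 1) choose j) = (M - j) * (M choose j)"
    by (metis binomial_absorb_comp)
  then have "real M * real ((M - 1) choose j) = real (M - j) * real (M choose j)"
    by (metis of_nat_mult)
  then show ?thesis using assms True by (simp add: of_nat_diff field_simps)
qed (simp add: binomial_eq_0)

section \<open>Containers\<close>

text \<open>Maximality replaces the greedy order: \<open>T\<close> is a maximal subset whose members
  contribute at least \<open>\<psi>\<close> elements on average, and a \<open>u\<close> adding more
  than \<open>\<psi>\<close> could still be inserted.\<close>

lemma exists_saturating_subset:
  fixes Nb :: "'a \<Rightarrow> 'b set" and \<psi> :: real
  assumes "finite A" "\<And>u. u \<in> A \<Longrightarrow> finite (Nb u)" "\<psi> \<ge> 0"
  shows "\<exists>T\<subseteq>A. \<psi> * real (card T) \<le> real (card (\<Union>(Nb ` T))) \<and>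
           (\<forall>u\<in>A. real (card (Nb u - \<Union>(Nb ` T))) \<le> \<psi>)"
proof -
  define P where "P = {T. T \<subseteq> A \<and> \<psi> * real (card T) \<le> real (card (\<Union>(Nb ` T)))}"
  have "finite P" unfolding P_def using assms(1) by auto
  moreover have "{} \<in> P" by (simp add: P_def)
  ultimately obtain T where T: "T \<in> P" and max: "\<And>T'. T' \<in> P \<Longrightarrow> T \<subseteq> T' \<Longrightarrow> T = T'"
    by (metis finite_has_maximal2)
  have fT: "finite T" using T assms(1) by (auto simp: P_def intro: finite_subset)
  have "real (card (Nb u - \<Union>(Nb ` T))) \<le> \<psi>" if u: "u \<in> A" for u
  proof (rule ccontr)
    assume neg: "\<not> ?thesis"
    have fU: "finite (\<Union>(Nb ` T))" using fT T assms(2) by (auto simp: P_def)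
    show False
    proof (cases "u \<in> T")
      case True
      then have empt: "Nb u - \<Union>(Nb ` T) = {}" by auto
      have "\<psi> < 0" using neg unfolding empt by simp
      then show False using assms(3) by simp
    next
      case False
      have "card (\<Union>(Nb ` insert u T)) = card ((Nb u - \<Union>(Nb ` T)) \<union> \<Union>(Nb ` T))"
        by (intro arg_cong[where f = card]) auto
      also have "\<dots> = card (Nb u - \<Union>(Nb ` T)) + card (\<Union>(Nb ` T))"
        using fU assms(2)[OF u] by (intro card_Un_disjoint) auto
      finally have "insert u T \<in> P"
        using neg T u fT False by (auto simp: P_def algebra_simps)
      then show False using max[of "insert u T"] False by auto
    qed
  qed
  then show ?thesis using T by (auto simp: P_def)
qed

text \<open>Exponential weights: a set of size at most \<open>\<sigma>\<close> has weight
  \<open>p powr (card T - \<sigma>) \<ge> 1\<close>, and over all subsets the weights sum to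
  \<open>p powr (-\<sigma>) * (1 + p) ^ card X\<close>. So each of \<open>\<sigma>\<close> elements
  costs \<open>log 2 (1 / p)\<close> bits.\<close>

lemma card_small_subsets:
  fixes p \<sigma> :: real
  assumes "finite X" "0 < p" "p \<le> 1"
  shows "real (card {T. T \<subseteq> X \<and> real (card T) \<le> \<sigma>}) \<le> p powr (-\<sigma>) * exp (p * real (card X))"
proof -
  let ?P = "{T. T \<subseteq> X \<and> real (card T) \<le> \<sigma>}"
  have "real (card ?P) = (\<Sum>T\<in>?P. 1)" by simp
  also have "\<dots> \<le> (\<Sum>T\<in>?P. p powr (-\<sigma>) * p ^ card T)"
  proof (rule sum_mono)
    fix T assume "T \<in> ?P"
    then have "p powr 0 \<le> p powr (real (card T) - \<sigma>)"
      using assms by (intro powr_mono') auto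
    then show "1 \<le> p powr (-\<sigma>) * p ^ card T"
      using assms by (simp add: powr_realpow[symmetric] powr_add[symmetric])
  qed
  also have "\<dots> \<le> (\<Sum>T\<in>Pow X. p powr (-\<sigma>) * p ^ card T)"
    using assms by (intro sum_mono2) auto
  also have "\<dots> = p powr (-\<sigma>) * (\<Sum>T\<in>Pow X. p ^ card T)"
    by (simp add: sum_distrib_left)
  also have "(\<Sum>T\<in>Pow X. p ^ card T) = (1 + p) ^ card X"
    using prod_add[OF assms(1), of "\<lambda>_. p" "\<lambda>_. 1"] by (simp add: add.commute)
  also have "p powr (-\<sigma>) * (1 + p) ^ card X \<le> p powr (-\<sigma>) * exp p ^ card X"
    using assms by (intro mult_left_mono power_mono) auto
  also have "exp p ^ card X = exp (p * real (card X))"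
    by (simp add: exp_of_nat_mult[symmetric] mult.commute)
  finally show ?thesis .
qed

text \<open>Double counting between the nearly covered \<open>u\<close> and \<open>F\<close>: each
  such \<open>u\<close> has at least \<open>d - \<theta>\<close> elements of \<open>Nb u\<close> in
  \<open>F\<close>, and each \<open>v\<close> in \<open>F\<close> belongs to \<open>Nb u\<close> for
  at most \<open>D\<close> of them.\<close>

lemma sparse_completion_card:
  fixes Nb :: "'a \<Rightarrow> 'b set" and \<theta> :: real
  assumes "finite X" "finite F"
    and "\<And>u. u \<in> X \<Longrightarrow> finite (Nb u) \<and> card (Nb u) = d"
    and "\<And>v. v \<in> F \<Longrightarrow> card {u\<in>X. v \<in> Nb u} \<le> D"
  shows "real (card {u\<in>X. real (card (Nb u - F)) \<le> \<theta>}) * (real d - \<theta>) \<le> real D * real (card F)"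
proof -
  let ?S = "{u\<in>X. real (card (Nb u - F)) \<le> \<theta>}"
  have fS: "finite ?S" using assms(1) by auto
  have "real (card ?S) * (real d - \<theta>) = (\<Sum>u\<in>?S. real d - \<theta>)" by simp
  also have "\<dots> \<le> (\<Sum>u\<in>?S. real (card {v\<in>F. v \<in> Nb u}))"
  proof (rule sum_mono)
    fix u assume u: "u \<in> ?S"
    then have fin: "finite (Nb u)" "card (Nb u) = d" using assms(3) by auto
    have "Nb u = (Nb u - F) \<union> {v\<in>F. v \<in> Nb u}" by auto
    also have "card \<dots> = card (Nb u - F) + card {v\<in>F. v \<in> Nb u}"
      using fin assms(2) by (intro card_Un_disjoint) auto
    finally show "real d - \<theta> \<le> real (card {v\<in>F. v \<in> Nb u})" using u fin by auto
  qed
  also have "\<dots> = real (\<Sum>u\<in>?S. card {v\<in>F. v \<in> Nb u})" by simp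
  also have "(\<Sum>u\<in>?S. card {v\<in>F. v \<in> Nb u}) = (\<Sum>v\<in>F. card {u\<in>?S. v \<in> Nb u})"
    using fS assms(2) by (rule sum_card_filter_swap)
  also have "\<dots> \<le> (\<Sum>v\<in>F. D)"
  proof (rule sum_mono)
    fix v assume v: "v \<in> F"
    have "card {u\<in>?S. v \<in> Nb u} \<le> card {u\<in>X. v \<in> Nb u}"
      using assms(1) by (intro card_mono) auto
    then show "card {u\<in>?S. v \<in> Nb u} \<le> D" using assms(4)[OF v] by simp
  qed
  finally show ?thesis by (simp add: mult.commute)
qed

text \<open>Three choices determine \<open>A\<close>: a set \<open>T\<^sub>0\<close> for the coarse
  threshold \<open>\<theta>\<close>, a set \<open>T\<^sub>1\<close> inside the container of
  \<open>T\<^sub>0\<close> for the fine threshold \<open>\<psi>\<close>, and a subset of the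
  container of \<open>T\<^sub>1\<close>. Only \<open>T\<^sub>0\<close> is named within all of
  \<open>X\<close>.\<close>

lemma container_count:
  fixes Nb :: "'a \<Rightarrow> 'b set" and \<theta> \<psi> g p\<^sub>0 p\<^sub>1 M b :: real
  assumes "finite X" "\<And>u. u \<in> X \<Longrightarrow> finite (Nb u)"
    and pos: "\<theta> > 0" "\<psi> > 0" "0 < p\<^sub>0" "p\<^sub>0 \<le> 1" "0 < p\<^sub>1" "p\<^sub>1 \<le> 1"
    and M: "\<And>T. T \<subseteq> X \<Longrightarrow> real (card (\<Union>(Nb ` T))) \<le> g \<Longrightarrow>
      real (card {u\<in>X. real (card (Nb u - \<Union>(Nb ` T))) \<le> \<theta>}) \<le> M"
    and b: "\<And>T. T \<subseteq> X \<Longrightarrow> real (card (\<Union>(Nb ` T))) \<le> g \<Longrightarrow>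
      real (card {u\<in>X. real (card (Nb u - \<Union>(Nb ` T))) \<le> \<psi>}) \<le> b"
  shows "real (card {A. A \<subseteq> X \<and> real (card (\<Union>(Nb ` A))) \<le> g})
    \<le> (p\<^sub>0 powr (- (g / \<theta>)) * exp (p\<^sub>0 * real (card X))) *
      ((p\<^sub>1 powr (- (g / \<psi>)) * exp (p\<^sub>1 * M)) * 2 powr b)"
proof -
  define c where "c \<phi> T = {u\<in>X. real (card (Nb u - \<Union>(Nb ` T))) \<le> \<phi>}" for \<phi> T
  define P where "P Z \<phi> = {T. T \<subseteq> Z \<and> real (card T) \<le> g / \<phi>} \<inter> {T. real (card (\<Union>(Nb ` T))) \<le> g}"
    for Z :: "'a set" and \<phi>
  have fc: "finite (c \<phi> T)" and cX: "c \<phi> T \<subseteq> X" for \<phi> T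
    using assms(1) by (auto simp: c_def)
  have fP: "finite (P Z \<phi>)" if "finite Z" for Z \<phi>
    using that by (auto simp: P_def intro: finite_subset[of _ "Pow Z"])
  have cP: "real (card (P Z \<phi>)) \<le> p powr (- (g / \<phi>)) * exp (p * real (card Z))"
    if "finite Z" "0 < p" "p \<le> 1" for Z \<phi> p
  proof -
    have "card (P Z \<phi>) \<le> card {T. T \<subseteq> Z \<and> real (card T) \<le> g / \<phi>}"
      unfolding P_def using that by (intro card_mono) auto
    then show ?thesis using card_small_subsets[OF that, of "g / \<phi>"] by linarith
  qed
  have "{A. A \<subseteq> X \<and> real (card (\<Union>(Nb ` A))) \<le> g}
      \<subseteq> (\<Union>T\<^sub>0\<in>P X \<theta>. \<Union>T\<^sub>1\<in>P (c \<theta> T\<^sub>0) \<psi>. Pow (c \<psi> T\<^sub>1))"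
  proof
    fix A assume "A \<in> {A. A \<subseteq> X \<and> real (card (\<Union>(Nb ` A))) \<le> g}"
    then have A: "A \<subseteq> X" "real (card (\<Union>(Nb ` A))) \<le> g" by auto
    have fA: "finite A" using A(1) assms(1) finite_subset by blast
    have finA: "finite (Nb u)" if "u \<in> A" for u using that A(1) assms(2) by auto
    have ex: "\<exists>T. T \<subseteq> A \<and> real (card T) \<le> g / \<phi> \<and> real (card (\<Union>(Nb ` T))) \<le> g \<and> A \<subseteq> c \<phi> T"
      if \<phi>: "\<phi> > 0" for \<phi>
    proof -
      obtain T where T: "T \<subseteq> A" "\<phi> * real (card T) \<le> real (card (\<Union>(Nb ` T)))"
        "\<forall>u\<in>A. real (card (Nb u - \<Union>(Nb ` T))) \<le> \<phi>"
        using exists_saturating_subset[where A = A and Nb = Nb and \<psi> = \<phi>] fA finA less_imp_le[OF \<phi>] by metis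
      have "finite (\<Union>(Nb ` A))" using fA A(1) assms(2) by auto
      then have "card (\<Union>(Nb ` T)) \<le> card (\<Union>(Nb ` A))" using T(1) by (intro card_mono) auto
      then have le: "real (card (\<Union>(Nb ` T))) \<le> g" using A(2) by linarith
      then have "real (card T) \<le> g / \<phi>" using T(2) \<phi> by (simp add: field_simps)
      then show ?thesis using T le A(1) by (auto simp: c_def)
    qed
    obtain T\<^sub>0 where T0: "T\<^sub>0 \<subseteq> A" "real (card T\<^sub>0) \<le> g / \<theta>" "real (card (\<Union>(Nb ` T\<^sub>0))) \<le> g" "A \<subseteq> c \<theta> T\<^sub>0"
      using ex[OF pos(1)] by blast
    obtain T\<^sub>1 where T1: "T\<^sub>1 \<subseteq> A" "real (card T\<^sub>1) \<le> g / \<psi>" "real (card (\<Union>(Nb ` T\<^sub>1))) \<le> g" "A \<subseteq> c \<psi> T\<^sub>1"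
      using ex[OF pos(2)] by blast
    have "T\<^sub>0 \<in> P X \<theta>" using T0 A(1) by (auto simp: P_def)
    moreover have "T\<^sub>1 \<in> P (c \<theta> T\<^sub>0) \<psi>" using T1 T0(4) by (auto simp: P_def)
    ultimately show "A \<in> (\<Union>T\<^sub>0\<in>P X \<theta>. \<Union>T\<^sub>1\<in>P (c \<theta> T\<^sub>0) \<psi>. Pow (c \<psi> T\<^sub>1))" using T1(4) by blast
  qed
  then have "card {A. A \<subseteq> X \<and> real (card (\<Union>(Nb ` A))) \<le> g}
      \<le> card (\<Union>T\<^sub>0\<in>P X \<theta>. \<Union>T\<^sub>1\<in>P (c \<theta> T\<^sub>0) \<psi>. Pow (c \<psi> T\<^sub>1))"
    using fP fc assms(1) by (intro card_mono) auto
  also have "\<dots> \<le> (\<Sum>T\<^sub>0\<in>P X \<theta>. card (\<Union>T\<^sub>1\<in>P (c \<theta> T\<^sub>0) \<psi>. Pow (c \<psi> T\<^sub>1)))"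
    using fP assms(1) by (intro card_UN_le) auto
  also have "\<dots> \<le> (\<Sum>T\<^sub>0\<in>P X \<theta>. \<Sum>T\<^sub>1\<in>P (c \<theta> T\<^sub>0) \<psi>. card (Pow (c \<psi> T\<^sub>1)))"
    using fP fc by (intro sum_mono card_UN_le) auto
  finally have "real (card {A. A \<subseteq> X \<and> real (card (\<Union>(Nb ` A))) \<le> g})
      \<le> (\<Sum>T\<^sub>0\<in>P X \<theta>. \<Sum>T\<^sub>1\<in>P (c \<theta> T\<^sub>0) \<psi>. real (card (Pow (c \<psi> T\<^sub>1))))"
    by (simp flip: of_nat_sum)
  also have "\<dots> \<le> (\<Sum>T\<^sub>0\<in>P X \<theta>. (p\<^sub>1 powr (- (g / \<psi>)) * exp (p\<^sub>1 * M)) * 2 powr b)"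
  proof (rule sum_mono)
    fix T\<^sub>0 assume T0: "T\<^sub>0 \<in> P X \<theta>"
    have cM: "real (card (c \<theta> T\<^sub>0)) \<le> M" using M[of T\<^sub>0] T0 by (auto simp: P_def c_def)
    have "(\<Sum>T\<^sub>1\<in>P (c \<theta> T\<^sub>0) \<psi>. real (card (Pow (c \<psi> T\<^sub>1)))) \<le> (\<Sum>T\<^sub>1\<in>P (c \<theta> T\<^sub>0) \<psi>. 2 powr b)"
    proof (rule sum_mono)
      fix T\<^sub>1 assume T1: "T\<^sub>1 \<in> P (c \<theta> T\<^sub>0) \<psi>"
      then have "T\<^sub>1 \<subseteq> X" using cX by (auto simp: P_def)
      then have "real (card (c \<psi> T\<^sub>1)) \<le> b" using b[of T\<^sub>1] T1 by (auto simp: P_def c_def)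
      then show "real (card (Pow (c \<psi> T\<^sub>1))) \<le> 2 powr b"
        using fc by (simp add: card_Pow powr_realpow[symmetric])
    qed
    also have "\<dots> = real (card (P (c \<theta> T\<^sub>0) \<psi>)) * 2 powr b" by simp
    also have "\<dots> \<le> (p\<^sub>1 powr (- (g / \<psi>)) * exp (p\<^sub>1 * real (card (c \<theta> T\<^sub>0)))) * 2 powr b"
      using cP[OF fc pos(5,6)] by (intro mult_right_mono) auto
    also have "\<dots> \<le> (p\<^sub>1 powr (- (g / \<psi>)) * exp (p\<^sub>1 * M)) * 2 powr b"
      using cM pos by (intro mult_right_mono mult_left_mono) auto
    finally show "(\<Sum>T\<^sub>1\<in>P (c \<theta> T\<^sub>0) \<psi>. real (card (Pow (c \<psi> T\<^sub>1))))
        \<le> (p\<^sub>1 powr (- (g / \<psi>)) * exp (p\<^sub>1 * M)) * 2 powr b" .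
  qed
  also have "\<dots> = real (card (P X \<theta>)) * ((p\<^sub>1 powr (- (g / \<psi>)) * exp (p\<^sub>1 * M)) * 2 powr b)"
    by simp
  also have "\<dots> \<le> (p\<^sub>0 powr (- (g / \<theta>)) * exp (p\<^sub>0 * real (card X))) *
      ((p\<^sub>1 powr (- (g / \<psi>)) * exp (p\<^sub>1 * M)) * 2 powr b)"
    using cP[OF assms(1) pos(3,4)] by (intro mult_right_mono) auto
  finally show ?thesis .
qed

section \<open>Binomial estimates and expansion with few missed neighbours\<close>

text \<open>The denominator does not depend on \<open>j\<close>, so it cancels in the quotient of
  two levels. Real subtraction keeps the formula valid for \<open>j > M\<close>.\<close>

lemma binomial_minus_5:
  fixes M j :: nat
  assumes "M \<ge> 5"
  defines "z \<equiv> real M - real j"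
  shows "real ((M - 5) choose j) = real (M choose j) *
    ((z * (z - 1) * (z - 2) * (z - 3) * (z - 4)) /
     (real M * (real M - 1) * (real M - 2) * (real M - 3) * (real M - 4)))"
proof -
  have s: "real ((M - Suc i) choose j) = real ((M - i) choose j) * ((z - real i) / (real M - real i))"
    if "i < 5" for i
  proof -
    have "real (M - i) = real M - real i" using assms that by (simp add: of_nat_diff)
    then show ?thesis
      using binomial_pred_top[of "M - i" j] assms that by (simp add: z_def algebra_simps)
  qed
  show ?thesis
    using s[of 0] s[of 1] s[of 2] s[of 3] s[of 4] by (simp add: mult_ac numeral_eq_Suc)
qed

text \<open>Compare coefficients of \<open>\<rho>\<close>: the right side gains at least
  \<open>(39/40) * (5/3) - 1/20 > 3/2\<close>, the left side needs at most
  \<open>5/4 + 1/12\<close>.\<close>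

lemma expansion_arith:
  fixes \<rho> \<tau> \<epsilon> P :: real
  assumes "\<rho> > 0" "\<rho> \<le> 1/3" "0 \<le> \<tau>" "\<tau> \<le> 1/40" "\<epsilon> \<le> \<rho> / 20"
    and "P \<ge> 1 + 5 * \<rho> / 3"
  shows "(1 + \<rho> / 4) * (1 + \<rho>) \<le> (1 - \<tau>) * P + \<tau> - \<epsilon>"
proof -
  have "(39/40) * (5 * \<rho> / 3) \<le> (1 - \<tau>) * (P - 1)"
    using assms by (intro mult_mono) auto
  moreover have "\<rho> * \<rho> \<le> \<rho> * (1/3)" using assms by (intro mult_left_mono) auto
  moreover have "(1 + \<rho> / 4) * (1 + \<rho>) = 1 + 5 * \<rho> / 4 + \<rho> * \<rho> / 4"
    by (simp add: field_simps)
  moreover have "(1 - \<tau>) * P + \<tau> = 1 + (1 - \<tau>) * (P - 1)" by (simp add: algebra_simps)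
  ultimately show ?thesis using assms by linarith
qed

text \<open>Monotonicity in the top reduces to \<open>q = 3\<close>, where the binomial is
  \<open>(k + 2) * (k + 1) * k / 6\<close>. This is the lower bound for \<open>d_X\<close> used
  throughout.\<close>

lemma binomial_ge_cube:
  assumes "q \<ge> 3" "k \<ge> 1"
  shows "real k ^ 3 / 6 \<le> real ((k + q - 1) choose (k - 1))"
proof -
  have "(k + 2) choose (k - 1) \<le> (k + q - 1) choose (k - 1)"
    using assms by (intro binomial_right_mono) auto
  moreover have "(k + 2) choose (k - 1) = (k + 2) choose 3"
    using assms by (subst binomial_symmetric) (auto simp: numeral_eq_Suc)
  moreover have "real k ^ 3 / 6 \<le> real ((k + 2) choose 3)"
  proof -
    have 1: "3 * ((k + 2) choose 3) = (k + 2) * ((k + 1) choose 2)"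
      using times_binomial_minus1_eq[of 3 "k + 2"] by simp
    have 2: "2 * ((k + 1) choose 2) = (k + 1) * k"
      using times_binomial_minus1_eq[of 2 "k + 1"] by simp
    have "6 * ((k + 2) choose 3) = 2 * (3 * ((k + 2) choose 3))" by simp
    also have "\<dots> = (k + 2) * (2 * ((k + 1) choose 2))" unfolding 1 by simp
    finally have "6 * ((k + 2) choose 3) = (k + 2) * ((k + 1) * k)" unfolding 2 .
    then have "6 * real ((k + 2) choose 3) = (real k + 2) * ((real k + 1) * real k)"
      by (metis of_nat_add of_nat_mult of_nat_numeral of_nat_1)
    then show ?thesis by (simp add: power3_eq_cube algebra_simps)
  qed
  ultimately show ?thesis by simp
qed

text \<open>By symmetry \<open>X\<close> is as large as level \<open>k\<close>, which is adjacent to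
  the level \<open>k - 1\<close> of \<open>Y\<close>; so
  \<open>|X| / |Y| = 1 + q / k\<close>.\<close>

lemma level_ratio:
  assumes "q \<ge> 1" "k \<ge> 1"
  shows "real ((2 * k + q - 1) choose (k - 1)) * (real k + real q)
    = real ((2 * k + q - 1) choose (k + q - 1)) * real k"
proof -
  have "k * ((2 * k + q - 1) choose k) = ((2 * k + q - 1) choose (k - 1)) * (k + q)"
    using assms binomial_absorb_comp[of "2 * k + q - 1" "k - 1"] binomial_absorption[of "k - 1" "2 * k + q - 1"]
    by (simp add: mult.commute)
  moreover have "(2 * k + q - 1) choose (k + q - 1) = (2 * k + q - 1) choose k"
    using assms by (subst binomial_symmetric) auto
  ultimately show ?thesis
    by (metis of_nat_add of_nat_mult mult.commute)
qed

text \<open>Kruskal--Katona is used only down to level \<open>l = k + 1\<close>; the last two levels are covered by degree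
  counting, since a set of size \<open>l\<close> has about \<open>k\<^sup>2 / 2\<close> subsets of size \<open>k - 1\<close>, many more than \<open>\<psi>\<close>.
  The hypothesis on \<open>card S\<close> with \<open>N - 5\<close> in place of \<open>N\<close> supplies the gain \<open>1 + 5 (q - 2) / k\<close>
  (\<open>P\<close> below), which outweighs the loss \<open>1 / (1 + \<rho>)\<close> between the level sizes.\<close>

lemma robust_expansion:
  assumes V: "finite V" "card V = 2 * k + q - 1" and q: "q \<ge> 3"
    and k: "3 * q \<le> k" "6400 \<le> k"
    and S: "\<And>u. u \<in> S \<Longrightarrow> u \<subseteq> V \<and> card u = k + q - 1"
    and F: "\<And>B. B \<in> F \<Longrightarrow> B \<subseteq> V \<and> card B = k - 1"
    and miss: "\<And>u. u \<in> S \<Longrightarrow>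
      real (card {B. B \<subseteq> u \<and> card B = k - 1 \<and> B \<notin> F}) \<le> real k * sqrt (real k)"
    and cS: "card S \<le> (2 * k + q - 6) choose (k + q - 1)"
  shows "(1 + real q / real k / 4) * real (card S) \<le> real (card F)"
proof -
  define N where "N = 2 * k + q - 1"
  define s where "s = k + q - 1"
  define r where "r = k - 1"
  define l where "l = k + 1"
  define \<rho> where "\<rho> = real q / real k"
  define \<psi> where "\<psi> = real k * sqrt (real k)"
  define \<tau> where "\<tau> = \<psi> / real (l choose r)"
  define \<epsilon> where "\<epsilon> = \<psi> / real (s choose r)"
  \<comment> \<open>\<open>w\<close> is \<open>N - l\<close> and \<open>k\<close> is
    \<open>N - s\<close>; \<open>P\<close> is the factor by which the ratio of level
    \<open>l\<close> to level \<open>s\<close> grows when \<open>N\<close> drops by five.\<close>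
  define w where "w = real k + real q - 2"
  define P where "P = (w * (w - 1) * (w - 2) * (w - 3) * (w - 4)) /
    (real k * (real k - 1) * (real k - 2) * (real k - 3) * (real k - 4))"
  have le: "r \<le> l" "l \<le> s" "s \<le> N" "1 \<le> l" using q k by (auto simp: r_def l_def s_def N_def)
  have sq: "sqrt (real k) \<ge> 80" using k by (intro real_le_rsqrt) auto
  have kpos: "real k > 0" using k by simp
  have \<rho>: "\<rho> > 0" "\<rho> \<le> 1/3" using q k by (auto simp: \<rho>_def field_simps)
  have \<psi>0: "\<psi> > 0" using sq k by (simp add: \<psi>_def)

  have lr: "real (l choose r) = (real k + 1) * real k / 2"
  proof -
    have "l choose r = (k + 1) choose 2"
      using binomial_symmetric[of 2 "k + 1"] k by (simp add: l_def r_def)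
    moreover have "2 * ((k + 1) choose 2) = (k + 1) * k"
      using times_binomial_minus1_eq[of 2 "k + 1"] by simp
    then have "2 * real ((k + 1) choose 2) = (real k + 1) * real k"
      by (metis of_nat_add of_nat_mult of_nat_numeral of_nat_1)
    ultimately show ?thesis by simp
  qed
  have sqk: "sqrt (real k) * sqrt (real k) = real k" by simp
  \<comment> \<open>\<open>\<tau>\<close> is below \<open>2 / sqrt k\<close>, and
    \<open>sqrt k \<ge> 80\<close>.\<close>
  have \<tau>: "0 \<le> \<tau>" "\<tau> \<le> 1/40"
  proof -
    show "0 \<le> \<tau>" using \<psi>0 by (simp add: \<tau>_def)
    have "80 * (real k * sqrt (real k)) \<le> sqrt (real k) * (real k * sqrt (real k))"
      using sq kpos by (intro mult_right_mono) auto
    also have "\<dots> = real k * real k" using sqk by (simp add: mult.left_commute)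
    also have "\<dots> \<le> (real k + 1) * real k" by (simp add: distrib_right)
    finally have "80 * \<psi> \<le> (real k + 1) * real k" by (simp only: \<psi>_def)
    then have "\<psi> \<le> (1/40) * ((real k + 1) * real k / 2)" by simp
    then show "\<tau> \<le> 1/40" unfolding \<tau>_def lr using kpos by (subst pos_divide_le_eq) auto
  qed
  have \<epsilon>: "\<epsilon> \<le> \<rho> / 20"
  proof -
    have d: "real k ^ 3 / 6 \<le> real (s choose r)"
      unfolding s_def r_def using q k by (intro binomial_ge_cube) auto
    have "80 * (real k * sqrt (real k)) \<le> sqrt (real k) * (real k * sqrt (real k))"
      using sq kpos by (intro mult_right_mono) auto
    also have "\<dots> = real k * real k" using sqk by (simp add: mult.left_commute)
    finally have \<psi>: "\<psi> \<le> real k ^ 2 / 80" by (simp add: \<psi>_def power2_eq_square)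
    have "\<epsilon> \<le> \<psi> / (real k ^ 3 / 6)"
      unfolding \<epsilon>_def using d \<psi>0 kpos le by (intro divide_left_mono mult_pos_pos) (auto simp: zero_less_binomial_iff)
    also have "\<dots> \<le> (real k ^ 2 / 80) / (real k ^ 3 / 6)"
      using \<psi> by (intro divide_right_mono) auto
    also have "\<dots> = 6 / (80 * real k)" using kpos by (simp add: power2_eq_square power3_eq_cube)
    also have "\<dots> \<le> \<rho> / 20" unfolding \<rho>_def using kpos q by (simp add: field_simps)
    finally show ?thesis .
  qed
  have P: "P \<ge> 1 + 5 * \<rho> / 3"
  proof -
    \<comment> \<open>Each of the five factors of \<open>P\<close> is at least \<open>1 + y\<close>;
      Bernoulli gives \<open>1 + 5 * y\<close>, and \<open>q \<ge> 3\<close> gives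
      \<open>q - 2 \<ge> q / 3\<close>, hence \<open>y \<ge> \<rho> / 3\<close>.\<close>
    define y where "y = (real q - 2) / real k"
    have y: "y \<ge> 0" using q kpos by (simp add: y_def)
    have fac: "1 + y \<le> (w - i) / (real k - i)" if "0 \<le> i" "i \<le> 4" for i
    proof -
      have "(w - i) / (real k - i) = 1 + (real q - 2) / (real k - i)"
        using that k by (simp add: w_def field_simps)
      moreover have "y \<le> (real q - 2) / (real k - i)"
        unfolding y_def using that q k by (intro divide_left_mono) auto
      ultimately show ?thesis by simp
    qed
    have "1 + 5 * y \<le> (1 + y) ^ 5" using Bernoulli_inequality[of y 5] y by simp
    also have "\<dots> = (1 + y) * (1 + y) * (1 + y) * (1 + y) * (1 + y)" by (simp add: numeral_eq_Suc)
    also have "\<dots> \<le> (w / real k) * ((w - 1) / (real k - 1)) * ((w - 2) / (real k - 2)) *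
        ((w - 3) / (real k - 3)) * ((w - 4) / (real k - 4))"
      using fac[of 0] fac[of 1] fac[of 2] fac[of 3] fac[of 4] y q k
      by (intro mult_mono mult_nonneg_nonneg divide_nonneg_nonneg) (auto simp: w_def)
    also have "\<dots> = P" by (simp add: P_def)
    finally have "1 + 5 * y \<le> P" .
    moreover have "\<rho> / 3 \<le> y" unfolding \<rho>_def y_def using q kpos by (simp add: field_simps)
    ultimately show ?thesis by linarith
  qed

  define \<kappa>\<^sub>0 where "\<kappa>\<^sub>0 = real (N choose l) / real (N choose s)"
  define \<kappa>\<^sub>1 where "\<kappa>\<^sub>1 = real ((N - 5) choose l) / real ((N - 5) choose s)"
  define \<kappa>\<^sub>2 where "\<kappa>\<^sub>2 = real (N choose r) / real (N choose l)"
  have bpos: "real (N choose l) > 0" "real (N choose s) > 0" "real (N choose r) > 0"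
    "real ((N - 5) choose s) > 0"
    using le q k by (auto simp: N_def s_def)
  have k1: "\<kappa>\<^sub>1 = \<kappa>\<^sub>0 * P"
  proof -
    have N5: "N \<ge> 5" using k by (simp add: N_def)
    have rl: "real N - real l = w" "real N - real s = real k"
      using q k by (auto simp: N_def l_def s_def w_def of_nat_diff)
    have Nk: "real N \<ge> real k + 6" using q k by (auto simp: N_def of_nat_diff)
    define E where "E = real N * (real N - 1) * (real N - 2) * (real N - 3) * (real N - 4)"
    have E: "E > 0" unfolding E_def using Nk kpos by (intro mult_pos_pos) auto
    define a where "a = w * (w - 1) * (w - 2) * (w - 3) * (w - 4)"
    define b where "b = real k * (real k - 1) * (real k - 2) * (real k - 3) * (real k - 4)"
    have b: "b > 0" unfolding b_def using k by (intro mult_pos_pos) auto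
    have Pab: "P = a / b" unfolding P_def a_def b_def ..
    have l: "real ((N - 5) choose l) = real (N choose l) * (a / E)"
      unfolding binomial_minus_5[OF N5] a_def E_def rl ..
    have s: "real ((N - 5) choose s) = real (N choose s) * (b / E)"
      unfolding binomial_minus_5[OF N5] b_def E_def rl ..
    show ?thesis unfolding \<kappa>\<^sub>1_def \<kappa>\<^sub>0_def l s Pab using E b bpos by (simp add: field_simps)
  qed
  have k02: "\<kappa>\<^sub>0 * \<kappa>\<^sub>2 * (1 + \<rho>) = 1"
  proof -
    have "\<kappa>\<^sub>0 * \<kappa>\<^sub>2 = real (N choose r) / real (N choose s)"
      unfolding \<kappa>\<^sub>0_def \<kappa>\<^sub>2_def using bpos by simp
    moreover have "real (N choose r) * (real k + real q) = real (N choose s) * real k"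
      unfolding N_def r_def s_def using q k by (intro level_ratio) auto
    moreover have "1 + \<rho> = (real k + real q) / real k"
      unfolding \<rho>_def using kpos by (simp add: add_divide_distrib)
    ultimately have "\<kappa>\<^sub>0 * \<kappa>\<^sub>2 * (1 + \<rho>) = (real (N choose s) * real k) / (real (N choose s) * real k)"
      by simp
    then show ?thesis using bpos kpos by simp
  qed
  have \<kappa>2: "\<kappa>\<^sub>2 > 0" unfolding \<kappa>\<^sub>2_def using bpos by simp
  have Sh: "\<kappa>\<^sub>1 * real (card S) \<le> real (card (shadow l S))"
  proof -
    have "card S * ((N - 5) choose l) \<le> card (shadow l S) * ((N - 5) choose s)"
      using V S cS le by (intro kruskal_katona_shadow[of V]) (auto simp: N_def s_def)
    then have "real (card S) * real ((N - 5) choose l) \<le> real (card (shadow l S)) * real ((N - 5) choose s)"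
      by (metis of_nat_le_iff of_nat_mult)
    then show ?thesis unfolding \<kappa>\<^sub>1_def using bpos by (simp add: field_simps)
  qed
  have "(1 - \<tau>) * real (card (shadow l S)) + (\<tau> - \<epsilon>) * \<kappa>\<^sub>0 * real (card S)
      \<le> real (N choose l) / real (N choose r) * real (card F)"
    unfolding \<tau>_def \<epsilon>_def \<kappa>\<^sub>0_def
    using V S F miss le by (intro robust_shadow) (auto simp: N_def s_def r_def \<psi>_def)
  also have "real (N choose l) / real (N choose r) = 1 / \<kappa>\<^sub>2" by (simp add: \<kappa>\<^sub>2_def)
  finally have "\<kappa>\<^sub>2 * ((1 - \<tau>) * real (card (shadow l S)) + (\<tau> - \<epsilon>) * \<kappa>\<^sub>0 * real (card S)) \<le> real (card F)"
    using \<kappa>2 by (simp add: field_simps)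
  moreover have "(1 - \<tau>) * (\<kappa>\<^sub>1 * real (card S)) \<le> (1 - \<tau>) * real (card (shadow l S))"
    using Sh \<tau> by (intro mult_left_mono) auto
  ultimately have "\<kappa>\<^sub>2 * ((1 - \<tau>) * (\<kappa>\<^sub>1 * real (card S)) + (\<tau> - \<epsilon>) * \<kappa>\<^sub>0 * real (card S)) \<le> real (card F)"
    using \<kappa>2 by (smt (verit) mult_left_mono)
  also have "\<kappa>\<^sub>2 * ((1 - \<tau>) * (\<kappa>\<^sub>1 * real (card S)) + (\<tau> - \<epsilon>) * \<kappa>\<^sub>0 * real (card S))
      = (\<kappa>\<^sub>0 * \<kappa>\<^sub>2) * (((1 - \<tau>) * P + \<tau> - \<epsilon>) * real (card S))"
    unfolding k1 by (simp add: algebra_simps)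
  finally have main: "(\<kappa>\<^sub>0 * \<kappa>\<^sub>2) * (((1 - \<tau>) * P + \<tau> - \<epsilon>) * real (card S)) \<le> real (card F)" .
  have \<kappa>02: "\<kappa>\<^sub>0 * \<kappa>\<^sub>2 > 0" using \<kappa>2 bpos by (simp add: \<kappa>\<^sub>0_def)
  have "(1 + \<rho> / 4) * real (card S) = (\<kappa>\<^sub>0 * \<kappa>\<^sub>2) * (((1 + \<rho> / 4) * (1 + \<rho>)) * real (card S))"
    using k02 by (metis (no_types, lifting) mult.assoc mult.commute mult_1)
  also have "\<dots> \<le> (\<kappa>\<^sub>0 * \<kappa>\<^sub>2) * (((1 - \<tau>) * P + \<tau> - \<epsilon>) * real (card S))"
    using expansion_arith[OF \<rho> \<tau> \<epsilon> P] \<kappa>02 by (intro mult_left_mono mult_right_mono) auto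
  finally show ?thesis using main by (simp add: \<rho>_def)
qed

section \<open>Counting in the three regimes\<close>

text \<open>\<open>H_edges\<close> is symmetric, so members of \<open>X\<close> must be kept apart
  from \<open>Y\<close> for the neighbourhood to consist of subsets only; the two sizes differ as
  \<open>k\<close> and \<open>q\<close> are positive.\<close>

lemma nbhd_eq_shadow:
  assumes "k \<ge> 1" "q \<ge> 1" "\<A> \<subseteq> X_part n k q x"
  shows "nbhd n k q x \<A> = shadow (k - 1) \<A>"
proof -
  have edge: "(A, B) \<in> H_edges n k q x \<longleftrightarrow> B \<in> Y_part n k x \<and> B \<subseteq> A" if "A \<in> \<A>" for A B
  proof -
    have "A \<in> X_part n k q x" using that assms(3) by auto
    moreover from this have "A \<notin> Y_part n k x" using assms by (auto simp: X_part_def Y_part_def)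
    ultimately show ?thesis by (auto simp: H_edges_def)
  qed
  show ?thesis
  proof
    show "nbhd n k q x \<A> \<subseteq> shadow (k - 1) \<A>"
      using edge by (auto simp: nbhd_def shadow_def Y_part_def)
    show "shadow (k - 1) \<A> \<subseteq> nbhd n k q x \<A>"
    proof
      fix B assume "B \<in> shadow (k - 1) \<A>"
      then obtain A where A: "A \<in> \<A>" "B \<subseteq> A" "card B = k - 1" by (auto simp: shadow_def)
      then have "B \<in> Y_part n k x" using assms(3) by (auto simp: X_part_def Y_part_def)
      then show "B \<in> nbhd n k q x \<A>" using A edge by (auto simp: nbhd_def)
    qed
  qed
qed

lemma shadow_eq_Union: "shadow r S = \<Union>((\<lambda>u. {B. B \<subseteq> u \<and> card B = r}) ` S)"
  by (auto simp: shadow_def)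

text \<open>Passing to the closure leaves the neighbourhood fixed. Thus Kruskal--Katona may be
  applied to the closure itself, bounding \<open>a\<close> and not just
  \<open>card \<A>\<close>.\<close>

lemma closure_props:
  assumes "k \<ge> 1" "q \<ge> 1" "\<A> \<subseteq> X_part n k q x"
  shows "\<A> \<subseteq> closure_X n k q x \<A>" "closure_X n k q x \<A> \<subseteq> X_part n k q x"
    "shadow (k - 1) (closure_X n k q x \<A>) = shadow (k - 1) \<A>"
proof -
  show sub: "\<A> \<subseteq> closure_X n k q x \<A>"
    using assms(3) by (auto simp: closure_X_def nbhd_def)
  show X: "closure_X n k q x \<A> \<subseteq> X_part n k q x" by (auto simp: closure_X_def)
  have "shadow (k - 1) {v} \<subseteq> shadow (k - 1) \<A>" if "v \<in> closure_X n k q x \<A>" for v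
  proof -
    have "{v} \<subseteq> X_part n k q x" using that X by auto
    then have "nbhd n k q x {v} = shadow (k - 1) {v}" using assms by (intro nbhd_eq_shadow)
    then show ?thesis using that nbhd_eq_shadow[OF assms] by (auto simp: closure_X_def)
  qed
  then show "shadow (k - 1) (closure_X n k q x \<A>) = shadow (k - 1) \<A>"
    using sub unfolding shadow_def by blast
qed

text \<open>The weight \<open>p = 2 powr (- n)\<close> makes each element cost \<open>n\<close> bits
  and leaves only the constant factor \<open>exp 1 \<le> 4\<close>.\<close>

lemma card_small_subsets_pow2:
  assumes "finite X" "real (card X) \<le> 2 ^ n"
  shows "real (card {T. T \<subseteq> X \<and> real (card T) \<le> \<sigma>}) \<le> 2 powr (real n * \<sigma> + 2)"
proof -
  define p :: real where "p = 2 powr (- real n)"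
  have p: "0 < p" "p \<le> 1" using ge_one_powr_ge_zero[of 2 "real n"] unfolding p_def by (auto simp: powr_minus_divide)
  have "p * real (card X) \<le> p * 2 ^ n" using assms p by (intro mult_left_mono) auto
  also have "\<dots> = 1" unfolding p_def by (simp add: powr_minus powr_realpow field_simps)
  finally have "exp (p * real (card X)) \<le> exp 1" by simp
  also have "\<dots> \<le> 2 powr 2" using exp_le by simp
  finally have e: "exp (p * real (card X)) \<le> 2 powr 2" .
  have "real (card {T. T \<subseteq> X \<and> real (card T) \<le> \<sigma>}) \<le> p powr (-\<sigma>) * exp (p * real (card X))"
    using assms p by (intro card_small_subsets)
  also have "\<dots> \<le> p powr (-\<sigma>) * 2 powr 2" using e by (intro mult_left_mono) auto
  also have "p powr (-\<sigma>) = 2 powr (real n * \<sigma>)" unfolding p_def by (simp add: powr_powr)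
  finally show ?thesis by (simp only: powr_add)
qed

text \<open>Removing one more point from the ground set multiplies the level size by
  \<open>(N - i - j) / (N - i) \<le> 1/2\<close>.\<close>

lemma choose_drop_halves:
  assumes "N \<le> 2 * j" "j > 0"
  shows "((N - i) choose j) * 2 ^ i \<le> N choose j"
proof (induction i)
  case (Suc i)
  show ?case
  proof (cases "N - i < j")
    case True
    then show ?thesis by (simp add: binomial_eq_0)
  next
    case False
    have "(N - i) * ((N - i - 1) choose j) = (N - i - j) * ((N - i) choose j)"
      by (metis binomial_absorb_comp)
    moreover have "2 * (N - i - j) \<le> N - i" using assms(1) by simp
    then have "2 * (N - i - j) * ((N - i) choose j) \<le> (N - i) * ((N - i) choose j)"
      by (intro mult_right_mono) auto
    ultimately have "(N - i) * (2 * ((N - i - 1) choose j)) \<le> (N - i) * ((N - i) choose j)"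
      by (simp only: mult.left_commute[of "N - i" 2] mult.assoc)
    then have "2 * ((N - Suc i) choose j) \<le> (N - i) choose j" using False assms(2) by simp
    then have "((N - Suc i) choose j) * 2 ^ Suc i \<le> ((N - i) choose j) * 2 ^ i" by simp
    then show ?thesis using Suc.IH by linarith
  qed
qed simp

text \<open>Up to level \<open>Q\<close>, consecutive levels grow by a factor of at least
  \<open>k / Q\<close>.\<close>

lemma choose_ratio:
  assumes "j + i \<le> Q" "Q + k \<le> m + 1"
  shows "(m choose j) * k ^ i \<le> (m choose (j + i)) * Q ^ i"
  using assms(1)
proof (induction i)
  case (Suc i)
  have "(m choose j) * k ^ Suc i \<le> (m choose (j + i)) * Q ^ i * k" using Suc by simp
  also have "\<dots> \<le> (m choose (j + i)) * Q ^ i * (m - (j + i))"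
    using Suc.prems assms(2) by (intro mult_left_mono) auto
  also have "\<dots> = (Suc (j + i) * (m choose Suc (j + i))) * Q ^ i"
    by (simp only: binomial_absorption binomial_absorb_comp[symmetric] mult_ac)
  also have "\<dots> \<le> (Q * (m choose Suc (j + i))) * Q ^ i"
    using Suc.prems by (intro mult_right_mono) auto
  finally show ?case by (simp add: mult_ac)
qed simp

lemma exp_le_2_powr:
  fixes y :: real
  assumes "y \<ge> 0"
  shows "exp y \<le> 2 powr (2 * y)"
proof -
  have "y * 1 \<le> y * (2 * ln 2)"
    using assms ln2_ge_two_thirds by (intro mult_left_mono) auto
  then show ?thesis by (simp add: powr_def mult_ac)
qed

text \<open>\<open>(k + q) choose q\<close> is the degree in \<open>H\<close> of a vertex of
  \<open>Y\<close>, and the binomial on the right is \<open>d_X\<close>; their ratio is again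
  \<open>|X| / |Y|\<close>.\<close>

lemma choose_degree:
  assumes "k \<ge> 1"
  shows "real ((k + q) choose q) * real k = real ((k + q - 1) choose (k - 1)) * (real k + real q)"
proof -
  have "k * ((k + q) choose k) = (k + q) * ((k + q - 1) choose (k - 1))"
    using assms by (intro times_binomial_minus1_eq) auto
  moreover have "(k + q) choose k = (k + q) choose q"
    using binomial_symmetric[of q "k + q"] by simp
  ultimately show ?thesis by (metis of_nat_add of_nat_mult mult.commute)
qed

text \<open>The containers have size at most \<open>g * (1 - 1 / (2 * k))\<close>, and naming the
  two selecting sets costs at most \<open>2/5 * g / k\<close> in the exponent; what remains of the
  saving is \<open>g / (10 * k)\<close>.\<close>

lemma container_regime:
  fixes g :: real
  assumes V: "finite V" "card V = 2 * k + q - 1" and q: "q \<ge> 3"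
    and k: "100 * q \<le> k" "6400 \<le> k"
    and asymp: "43 / real k + 2 * log 2 (real k) / sqrt (real k) \<le> 2 / 5"
    and g: "2 * real k ^ 2 \<le> g" "40 * g \<le> real ((2 * k + q - 1) choose (k - 1))"
  defines "X \<equiv> {A. A \<subseteq> V \<and> card A = k + q - 1}"
  shows "real (card {\<A>. \<A> \<subseteq> X \<and> real (card (shadow (k - 1) \<A>)) \<le> g})
    \<le> 2 powr (g * (1 - 1 / (10 * real k)))"
proof -
  define N where "N = 2 * k + q - 1"
  define s where "s = k + q - 1"
  define r where "r = k - 1"
  define d where "d = real (s choose r)"
  define D where "D = (k + q) choose q"
  define \<rho> where "\<rho> = real q / real k"
  define \<psi> where "\<psi> = real k * sqrt (real k)"
  define Nb where "Nb u = {B::'a set. B \<subseteq> u \<and> card B = r}" for u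
  have kpos: "real k > 0" using k by simp
  have sq: "sqrt (real k) \<ge> 80" using k by (intro real_le_rsqrt) auto
  have sqk: "sqrt (real k) * sqrt (real k) = real k" by simp
  have \<rho>: "\<rho> > 0" "\<rho> \<le> 1/100" "3 / real k \<le> \<rho>" using q k by (auto simp: \<rho>_def field_simps)
  have g0: "g > 0" using g(1) kpos by (smt (verit) zero_less_power)
  have \<psi>0: "\<psi> > 0" using sq k by (simp add: \<psi>_def)
  have X: "finite X" "card X = N choose s"
    unfolding X_def using V by (auto simp: n_subsets N_def s_def)
  have d: "real k ^ 3 / 6 \<le> d"
    unfolding d_def s_def r_def using q k by (intro binomial_ge_cube) auto
  have dpos: "d > 0" using d kpos by (smt (verit) zero_less_power divide_pos_pos)
  have D: "real D = (1 + \<rho>) * d"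
  proof -
    have "real D * real k = d * (real k + real q)"
      unfolding D_def d_def s_def r_def using k by (intro choose_degree) auto
    then show ?thesis unfolding \<rho>_def using kpos by (simp add: field_simps)
  qed
  have XY: "(1 + \<rho>) * real (N choose r) = real (N choose s)"
  proof -
    have "real (N choose r) * (real k + real q) = real (N choose s) * real k"
      unfolding N_def r_def s_def using q k by (intro level_ratio) auto
    then show ?thesis unfolding \<rho>_def using kpos by (simp add: field_simps)
  qed
  have \<psi>d: "\<psi> \<le> d / 100"
  proof -
    have "80 * (real k * sqrt (real k)) \<le> sqrt (real k) * (real k * sqrt (real k))"
      using sq kpos by (intro mult_right_mono) auto
    also have "\<dots> = real k * real k" using sqk by (simp add: mult.left_commute)
    finally have "80 * \<psi> \<le> real k ^ 2" by (simp add: \<psi>_def power2_eq_square)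
    moreover have "8 * real k ^ 2 \<le> real k ^ 3"
      using k mult_right_mono[of 8 "real k" "real k ^ 2"] by (simp add: power2_eq_square power3_eq_cube)
    ultimately show ?thesis using d zero_le_power2[of "real k"] by linarith
  qed

  have Nb: "finite (Nb u) \<and> card (Nb u) = s choose r" if "u \<in> X" for u
  proof -
    have "finite u" "card u = s" using that V(1) by (auto simp: X_def s_def intro: finite_subset)
    then show ?thesis by (simp add: Nb_def n_subsets)
  qed
  have F1: "finite (\<Union>(Nb ` T))" if "T \<subseteq> X" for T
    using finite_subset[OF that X(1)] Nb that by auto
  have F2: "B \<subseteq> V \<and> card B = r" if "T \<subseteq> X" "B \<in> \<Union>(Nb ` T)" for T B
    using that by (auto simp: X_def Nb_def)
  have deg: "card {u\<in>X. B \<in> Nb u} \<le> D" if "B \<subseteq> V" "card B = r" for B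
  proof -
    have "card {u\<in>X. B \<in> Nb u} \<le> card {u. B \<subseteq> u \<and> u \<subseteq> V \<and> card u = s}"
      using V(1) by (intro card_mono) (auto simp: X_def Nb_def s_def)
    also have "\<dots> = (N - r) choose (s - r)"
      using card_between_sets[of V B s] that V by (simp add: N_def s_def r_def)
    also have "\<dots> = D" using k q by (simp add: D_def N_def s_def r_def)
    finally show ?thesis .
  qed
  have completion: "real (card {u\<in>X. real (card (Nb u - \<Union>(Nb ` T))) \<le> \<phi>}) * (d - \<phi>) \<le> (1 + \<rho>) * d * g"
    if T: "T \<subseteq> X" "real (card (\<Union>(Nb ` T))) \<le> g" for T \<phi>
  proof -
    have "real (card {u\<in>X. real (card (Nb u - \<Union>(Nb ` T))) \<le> \<phi>}) * (d - \<phi>)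
        \<le> real D * real (card (\<Union>(Nb ` T)))"
      unfolding d_def using X(1) F1[OF T(1)] Nb deg F2[OF T(1)] by (intro sparse_completion_card) auto
    also have "\<dots> \<le> real D * g" using T(2) by (intro mult_left_mono) auto
    finally show ?thesis unfolding D .
  qed

  \<comment> \<open>Asking for only half of each neighbourhood costs a factor of 2, and
    \<open>2 * (1 + \<rho>) \<le> 3\<close>.\<close>
  have M: "real (card {u\<in>X. real (card (Nb u - \<Union>(Nb ` T))) \<le> d / 2}) \<le> 3 * g"
    if T: "T \<subseteq> X" "real (card (\<Union>(Nb ` T))) \<le> g" for T
  proof -
    have "real (card {u\<in>X. real (card (Nb u - \<Union>(Nb ` T))) \<le> d / 2}) * (d - d / 2) \<le> (1 + \<rho>) * d * g"
      by (rule completion[OF T])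
    also have "\<dots> \<le> (3 / 2) * d * g" using \<rho> dpos g0 by (intro mult_right_mono) auto
    finally have "(d / 2) * real (card {u\<in>X. real (card (Nb u - \<Union>(Nb ` T))) \<le> d / 2}) \<le> (d / 2) * (3 * g)"
      by (simp add: mult_ac)
    then show ?thesis using dpos by (rule mult_left_le_imp_le[OF _ half_gt_zero])
  qed

  \<comment> \<open>\<open>N \<le> 2.01 * k\<close> makes each of the five factors nearly 1/2. The
    constant \<open>39\<close> sits between \<open>(200/97) ^ 5\<close> and
    \<open>40 * 99/100\<close>, the divisor of \<open>card X\<close> available for
    \<open>card S\<close> below.\<close>
  have X5: "(1/39) * real (card X) \<le> real ((N - 5) choose s)"
  proof -
    have N5: "N \<ge> 5" using k by (simp add: N_def)
    have rl: "real N - real s = real k" using q k by (auto simp: N_def s_def of_nat_diff)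
    have Nk: "real N \<ge> real k + 5" "real N \<le> 2 * real k + real q" using q k by (auto simp: N_def of_nat_diff)
    have fac: "97/200 \<le> (real k - i) / (real N - i)" if "0 \<le> i" "i \<le> 4" for i
    proof -
      have "(97/200) * (real N - i) \<le> real k - i" using that Nk k by simp
      then show ?thesis using that Nk kpos by (subst pos_le_divide_eq) auto
    qed
    have "1/39 \<le> (97/200) * (97/200) * (97/200) * (97/200) * (97/200::real)" by simp
    also have "\<dots> \<le> (real k / real N) * ((real k - 1) / (real N - 1)) * ((real k - 2) / (real N - 2)) *
        ((real k - 3) / (real N - 3)) * ((real k - 4) / (real N - 4))"
      using fac[of 0] fac[of 1] fac[of 2] fac[of 3] fac[of 4] Nk k
      by (intro mult_mono mult_nonneg_nonneg divide_nonneg_nonneg) auto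
    also have "\<dots> = (real k * (real k - 1) * (real k - 2) * (real k - 3) * (real k - 4)) /
        (real N * (real N - 1) * (real N - 2) * (real N - 3) * (real N - 4))" by simp
    finally have "real (N choose s) * (1/39) \<le> real (N choose s) * \<dots>" by (intro mult_left_mono) auto
    then show ?thesis unfolding X(2) binomial_minus_5[OF N5] rl by (simp add: mult.commute)
  qed

  have b: "real (card {u\<in>X. real (card (Nb u - \<Union>(Nb ` T))) \<le> \<psi>}) \<le> g * (1 - 1 / (2 * real k))"
    if T: "T \<subseteq> X" "real (card (\<Union>(Nb ` T))) \<le> g" for T
  proof -
    define S where "S = {u\<in>X. real (card (Nb u - \<Union>(Nb ` T))) \<le> \<psi>}"
    have "real (card S) * (99/100 * d) \<le> real (card S) * (d - \<psi>)"
      using \<psi>d by (intro mult_left_mono) auto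
    also have "\<dots> \<le> (1 + \<rho>) * d * g" unfolding S_def by (rule completion[OF T])
    finally have "d * (99/100 * real (card S)) \<le> d * ((1 + \<rho>) * g)" by (simp add: mult_ac)
    then have 1: "99/100 * real (card S) \<le> (1 + \<rho>) * g" using dpos by (rule mult_left_le_imp_le)
    have "(1 + \<rho>) * (40 * g) \<le> (1 + \<rho>) * real (N choose r)"
      using g(2) \<rho> by (intro mult_left_mono) (auto simp: N_def r_def)
    also have "\<dots> = real (card X)" using XY X by simp
    finally have "real (card S) \<le> (1/39) * real (card X)" using 1 by linarith
    then have cS: "card S \<le> (N - 5) choose s" using X5 by linarith
    have "(1 + real q / real k / 4) * real (card S) \<le> real (card (\<Union>(Nb ` T)))"
    proof (rule robust_expansion[OF V q])
      show "3 * q \<le> k" "6400 \<le> k" using k by auto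
      show "u \<subseteq> V \<and> card u = k + q - 1" if "u \<in> S" for u using that by (auto simp: S_def X_def)
      show "B \<subseteq> V \<and> card B = k - 1" if "B \<in> \<Union>(Nb ` T)" for B
        using F2[OF T(1) that] by (simp add: r_def)
      show "real (card {B. B \<subseteq> u \<and> card B = k - 1 \<and> B \<notin> \<Union>(Nb ` T)}) \<le> real k * sqrt (real k)"
        if "u \<in> S" for u
      proof -
        have "{B. B \<subseteq> u \<and> card B = k - 1 \<and> B \<notin> \<Union>(Nb ` T)} = Nb u - \<Union>(Nb ` T)"
          unfolding Nb_def r_def by blast
        then show ?thesis using that by (simp add: S_def \<psi>_def)
      qed
      show "card S \<le> (2 * k + q - 6) choose (k + q - 1)" using cS by (simp add: N_def s_def)
    qed
    then have 2: "(1 + \<rho> / 4) * real (card S) \<le> g" using T(2) by (simp add: \<rho>_def)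
    \<comment> \<open>\<open>q \<ge> 3\<close> gives \<open>\<rho> \<ge> 3 / k\<close>, and
      \<open>1 / (1 + 3 / (4 * k)) \<le> 1 - 1 / (2 * k)\<close>.\<close>
    define c where "c = 1 - 1 / (2 * real k)"
    have c0: "c \<ge> 0" using k by (simp add: c_def)
    have "1 \<le> c * (1 + 3 / real k / 4)"
    proof -
      have "1 \<le> 1 / (4 * real k) * (real k - 3/2) + 1" using k by simp
      then show ?thesis unfolding c_def using k by (simp add: field_simps power2_eq_square)
    qed
    also have "\<dots> \<le> c * (1 + \<rho> / 4)" using \<rho>(3) c0 by (intro mult_left_mono) auto
    finally have "1 * real (card S) \<le> c * (1 + \<rho> / 4) * real (card S)" by (intro mult_right_mono) auto
    also have "\<dots> = c * ((1 + \<rho> / 4) * real (card S))" by (simp only: mult.assoc)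
    also have "\<dots> \<le> c * g" using 2 c0 by (intro mult_left_mono)
    finally show ?thesis by (simp add: c_def S_def mult.commute)
  qed

  \<comment> \<open>\<open>p\<^sub>0\<close> charges \<open>N\<close> bits per element, affordable
    for the at most \<open>2 * g / d\<close> elements of the first set. \<open>p\<^sub>1\<close>
    charges only \<open>2 * log 2 k\<close> bits, which suffices because the second set is named
    within at most \<open>3 * g\<close> elements.\<close>
  define p\<^sub>0 :: real where "p\<^sub>0 = 2 powr (- real N)"
  define p\<^sub>1 :: real where "p\<^sub>1 = 1 / real k ^ 2"
  have p0: "0 < p\<^sub>0" "p\<^sub>0 \<le> 1"
    using ge_one_powr_ge_zero[of 2 "real N"] unfolding p\<^sub>0_def by (auto simp: powr_minus_divide)
  have p1: "0 < p\<^sub>1" "p\<^sub>1 \<le> 1" using k one_le_power[of "real k" 2] by (auto simp: p\<^sub>1_def)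
  have count: "real (card {\<A>. \<A> \<subseteq> X \<and> real (card (\<Union>(Nb ` \<A>))) \<le> g})
    \<le> (p\<^sub>0 powr (- (g / (d / 2))) * exp (p\<^sub>0 * real (card X))) *
      ((p\<^sub>1 powr (- (g / \<psi>)) * exp (p\<^sub>1 * (3 * g))) * 2 powr (g * (1 - 1 / (2 * real k))))"
    using X(1) Nb dpos \<psi>0 p0 p1 M b by (intro container_count) auto

  have e1: "p\<^sub>0 powr (- (g / (d / 2))) \<le> 2 powr (36 * g / real k ^ 2)"
  proof -
    have "real N \<le> 3 * real k" using k by (auto simp: N_def of_nat_diff)
    then have "real N * (g / (d / 2)) \<le> (3 * real k) * (g / (real k ^ 3 / 6 / 2))"
      using g0 d kpos dpos by (intro mult_mono divide_left_mono mult_pos_pos) auto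
    also have "\<dots> = 36 * g / real k ^ 2"
      using kpos by (simp add: power2_eq_square power3_eq_cube)
    finally show ?thesis unfolding p\<^sub>0_def by (simp add: powr_powr)
  qed
  have e2: "exp (p\<^sub>0 * real (card X)) \<le> 2 powr (g / real k ^ 2)"
  proof -
    have "N choose s \<le> 2 ^ N" by (rule binomial_le_pow2)
    then have "real (card X) \<le> 2 ^ N" unfolding X(2) by (metis of_nat_le_iff of_nat_numeral of_nat_power)
    then have "p\<^sub>0 * real (card X) \<le> p\<^sub>0 * 2 ^ N" using p0 by (intro mult_left_mono) auto
    also have "\<dots> = 1" unfolding p\<^sub>0_def by (simp add: powr_minus powr_realpow field_simps)
    finally have "exp (p\<^sub>0 * real (card X)) \<le> exp 1" by simp
    also have "\<dots> \<le> 2 powr (2 * 1)" by (rule exp_le_2_powr) simp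
    also have "\<dots> \<le> 2 powr (g / real k ^ 2)"
      using g(1) kpos by (intro powr_mono) (auto simp: field_simps)
    finally show ?thesis .
  qed
  have e3: "p\<^sub>1 powr (- (g / \<psi>)) = 2 powr (2 * log 2 (real k) * g / (real k * sqrt (real k)))"
  proof -
    have "p\<^sub>1 = real k powr (-2)" using kpos by (simp add: p\<^sub>1_def powr_minus_divide)
    also have "\<dots> = (2 powr log 2 (real k)) powr (-2)" using kpos by simp
    also have "\<dots> = 2 powr (- (2 * log 2 (real k)))" by (simp only: powr_powr) (simp add: mult.commute)
    finally show ?thesis by (simp add: powr_powr \<psi>_def)
  qed
  have e4: "exp (p\<^sub>1 * (3 * g)) \<le> 2 powr (6 * g / real k ^ 2)"
    using exp_le_2_powr[of "p\<^sub>1 * (3 * g)"] p1 g0 by (simp add: p\<^sub>1_def)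

  have "real (card {\<A>. \<A> \<subseteq> X \<and> real (card (\<Union>(Nb ` \<A>))) \<le> g})
    \<le> (2 powr (36 * g / real k ^ 2) * 2 powr (g / real k ^ 2)) *
      ((2 powr (2 * log 2 (real k) * g / (real k * sqrt (real k))) * 2 powr (6 * g / real k ^ 2))
        * 2 powr (g * (1 - 1 / (2 * real k))))"
    using e1 e2 e4 unfolding e3[symmetric]
    by (intro order.trans[OF count] mult_mono mult_nonneg_nonneg) auto
  also have "\<dots> = 2 powr (36 * g / real k ^ 2 + g / real k ^ 2 + (2 * log 2 (real k) * g / (real k * sqrt (real k))
      + 6 * g / real k ^ 2 + g * (1 - 1 / (2 * real k))))"
    by (simp only: powr_add)
  \<comment> \<open>The terms of order \<open>g / k ^ 2\<close> collect to
    \<open>43 = 36 + 1 + 6\<close>. Since \<open>asymp\<close> bounds the bracket by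
    \<open>2/5\<close>, the net saving is \<open>1/2 - 2/5 = 1/10\<close> of
    \<open>g / k\<close>.\<close>
  also have "36 * g / real k ^ 2 + g / real k ^ 2 + (2 * log 2 (real k) * g / (real k * sqrt (real k))
      + 6 * g / real k ^ 2 + g * (1 - 1 / (2 * real k)))
      = g / real k * (43 / real k + 2 * log 2 (real k) / sqrt (real k)) + g - g / real k / 2"
    using kpos by (simp add: field_simps power2_eq_square)
  also have "2 powr \<dots> \<le> 2 powr (g * (1 - 1 / (10 * real k)))"
  proof (rule powr_mono)
    have "g / real k * (43 / real k + 2 * log 2 (real k) / sqrt (real k)) \<le> g / real k * (2 / 5)"
      using asymp g0 kpos by (intro mult_left_mono) auto
    then show "g / real k * (43 / real k + 2 * log 2 (real k) / sqrt (real k)) + g - g / real k / 2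
        \<le> g * (1 - 1 / (10 * real k))"
      by (simp add: right_diff_distrib)
  qed simp
  finally show ?thesis unfolding shadow_eq_Union Nb_def r_def .
qed

text \<open>With \<open>g\<close> comparable to \<open>|Y|\<close>, the size bound on
  \<open>\<A>\<close> is enough: the exponent \<open>9 * a + card X / 256\<close> is at most
  \<open>11 * card X / 512\<close>, and \<open>card X \<le> 40.4 * g\<close> brings this below
  \<open>9/10 * g\<close>.\<close>

lemma trivial_regime:
  fixes g :: real
  assumes V: "finite V" "card V = 2 * k + q - 1" and q: "q \<ge> 1"
    and k: "100 * q \<le> k"
    and a: "a \<le> (2 * k + q - 10) choose (k + q - 1)"
    and g: "real ((2 * k + q - 1) choose (k - 1)) \<le> 40 * g"
  defines "X \<equiv> {A. A \<subseteq> V \<and> card A = k + q - 1}"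
  shows "real (card {\<A>. \<A> \<subseteq> X \<and> card \<A> \<le> a}) \<le> 2 powr (g * (9 / 10))"
proof -
  define N where "N = 2 * k + q - 1"
  define s where "s = k + q - 1"
  have X: "finite X" "card X = N choose s"
    unfolding X_def using V by (auto simp: n_subsets N_def s_def)
  \<comment> \<open>\<open>T0\<close> has top \<open>n - 10 = N - 9\<close>, so nine halvings
    separate it from \<open>card X\<close>.\<close>
  have "a * 2 ^ 9 \<le> ((N - 9) choose s) * 2 ^ 9" using a by (simp add: N_def s_def)
  also have "\<dots> \<le> card X"
    unfolding X(2) using q k by (intro choose_drop_halves) (auto simp: N_def s_def)
  finally have "real (a * 2 ^ 9) \<le> real (card X)" by (simp only: of_nat_le_iff)
  then have a: "real a \<le> real (card X) / 512" by simp
  have "real (card X) * real k = real (N choose (k - 1)) * (real k + real q)"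
    unfolding X(2) N_def s_def using q k by (subst level_ratio) auto
  also have "\<dots> \<le> (40 * g) * (101 / 100 * real k)"
  proof (rule mult_mono)
    show "real (N choose (k - 1)) \<le> 40 * g" using g by (simp add: N_def)
    then show "0 \<le> 40 * g" by (rule order.trans[rotated]) simp
    show "real k + real q \<le> 101 / 100 * real k" using k by simp
  qed simp
  finally have "real (card X) * real k \<le> (404 / 10 * g) * real k" by simp
  then have Xg: "real (card X) \<le> 404 / 10 * g" using q k by simp
  have "real (card {\<A>. \<A> \<subseteq> X \<and> card \<A> \<le> a}) = real (card {\<A>. \<A> \<subseteq> X \<and> real (card \<A>) \<le> real a})"
    by simp
  also have "\<dots> \<le> (1 / 512) powr (- real a) * exp (1 / 512 * real (card X))"
    using X(1) by (intro card_small_subsets) auto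
  also have "(1 / 512 :: real) powr (- real a) = 2 powr (9 * real a)"
  proof -
    have "(1 / 512 :: real) = 2 powr (- 9)" by (simp add: powr_minus_divide)
    then show ?thesis by (simp only: powr_powr) simp
  qed
  also have "2 powr (9 * real a) * exp (1 / 512 * real (card X))
      \<le> 2 powr (9 * real a) * 2 powr (2 * (1 / 512 * real (card X)))"
    by (intro mult_left_mono exp_le_2_powr) auto
  also have "\<dots> = 2 powr (9 * real a + 2 * (1 / 512 * real (card X)))" by (simp only: powr_add)
  also have "\<dots> \<le> 2 powr (g * (9 / 10))"
  proof (rule powr_mono)
    have "g \<ge> 0" using order.trans[OF of_nat_0_le_iff Xg] by simp
    then show "9 * real a + 2 * (1 / 512 * real (card X)) \<le> g * (9 / 10)" using a Xg by simp
  qed simp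
  finally show ?thesis .
qed

text \<open>Kruskal--Katona with \<open>m = k + 4 * q - 1\<close>, chosen so that levels
  \<open>k - 1\<close> and \<open>k + q - 1\<close> are by symmetry levels \<open>4 * q\<close> and
  \<open>3 * q\<close>. The first still has size at least \<open>d_X ^ 3\<close>, and the ratio of
  the second to the first is at most \<open>(4 * q / k) ^ q \<le> 1 / (12 * k)\<close>.\<close>

lemma small_regime:
  assumes V: "finite V" "card V = 2 * k + q - 1" and q: "q \<ge> 3"
    and k: "2048 * q ^ 4 \<le> k"
    and C: "\<C> \<subseteq> {A. A \<subseteq> V \<and> card A = k + q - 1}"
    and g: "card (shadow (k - 1) \<C>) \<le> ((k + q - 1) choose (k - 1)) ^ 3"
  shows "12 * k * card \<C> \<le> card (shadow (k - 1) \<C>)"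
proof -
  define m where "m = k + 4 * q - 1"
  define g where "g = card (shadow (k - 1) \<C>)"
  have q4: "q ^ 4 \<ge> q ^ 3" "q ^ 4 \<ge> q" "q ^ 4 \<ge> 1"
    using q power_increasing[of 3 4 q] power_increasing[of 1 4 q] power_increasing[of 0 4 q] by auto
  have kq: "q \<le> k" "1 \<le> k" using q4 k by linarith+
  have "m - 4 * q = k - 1" "m - 3 * q = k + q - 1" "4 * q \<le> m" "3 * q \<le> m"
    using q kq by (auto simp: m_def)
  then have sym: "m choose (k - 1) = m choose (4 * q)" "m choose (k + q - 1) = m choose (3 * q)"
    using binomial_symmetric[of "4 * q" m] binomial_symmetric[of "3 * q" m] by metis+
  \<comment> \<open>The chain is \<open>d_X ^ 3 \<le> (8 * k ^ 3) ^ q \<le> (k / (4 * q)) ^ (4 * q)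
    \<le> m choose (4 * q)\<close>; its middle step is \<open>2048 * q ^ 4 \<le> k\<close>, with
    \<open>2048 = 8 * 4 ^ 4\<close>.\<close>
  have "real (((k + q - 1) choose (k - 1)) ^ 3) \<le> real (m choose (4 * q))"
  proof -
    have "(k + q - 1) choose (k - 1) = (k + q - 1) choose q"
      using q kq binomial_symmetric[of q "k + q - 1"] by simp
    also have "\<dots> \<le> (k + q - 1) ^ q" using kq by (intro binomial_le_pow) auto
    also have "\<dots> \<le> (2 * k) ^ q" using kq by (intro power_mono) auto
    finally have "((k + q - 1) choose (k - 1)) ^ 3 \<le> ((2 * k) ^ q) ^ 3" by (intro power_mono) auto
    also have "\<dots> = ((2 * k) ^ 3) ^ q" by (simp only: power_mult[symmetric] mult.commute)
    also have "(2 * k) ^ 3 = 8 * k ^ 3" by (simp add: power_mult_distrib)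
    finally have "real (((k + q - 1) choose (k - 1)) ^ 3) \<le> real ((8 * k ^ 3) ^ q)" by (simp only: of_nat_le_iff)
    also have "\<dots> = (8 * real k ^ 3) ^ q" by simp
    also have "\<dots> \<le> ((real k / (4 * real q)) ^ 4) ^ q"
    proof (rule power_mono)
      have "real (2048 * q ^ 4) \<le> real k" using k by (simp only: of_nat_le_iff)
      then have "real (2048 * q ^ 4) * real k ^ 3 \<le> real k * real k ^ 3"
        by (rule mult_right_mono) simp
      then have "8 * real k ^ 3 * (4 * real q) ^ 4 \<le> real k ^ 4"
        by (simp add: power_mult_distrib numeral_eq_Suc mult_ac)
      then show "8 * real k ^ 3 \<le> (real k / (4 * real q)) ^ 4"
        unfolding power_divide using q by (subst pos_le_divide_eq) auto
    qed simp
    also have "\<dots> = (real k / real (4 * q)) ^ (4 * q)" by (simp add: power_mult[symmetric])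
    also have "\<dots> \<le> (real m / real (4 * q)) ^ (4 * q)"
      using q by (intro power_mono divide_right_mono) (auto simp: m_def)
    also have "\<dots> \<le> real (m choose (4 * q))"
      using kq by (intro binomial_ge_n_over_k_pow_k) (auto simp: m_def)
    finally show ?thesis .
  qed
  then have gm: "g \<le> m choose (k - 1)" using assms(6) unfolding sym g_def by linarith
  have "card \<C> * (m choose (k - 1)) \<le> g * (m choose (k + q - 1))"
    unfolding g_def using V C gm q q4 k by (intro kruskal_katona_levels[of V]) (auto simp: g_def)
  then have 1: "card \<C> * (m choose (4 * q)) \<le> g * (m choose (3 * q))" unfolding sym .
  have "(m choose (3 * q)) * k ^ q \<le> (m choose (3 * q + q)) * (4 * q) ^ q"
    by (rule choose_ratio) (auto simp: m_def)
  then have 2: "(m choose (3 * q)) * k ^ q \<le> (m choose (4 * q)) * (4 * q) ^ q" by simp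
  \<comment> \<open>Three of the \<open>q\<close> factors already give the extra
    \<open>12 * k\<close>; the other \<open>q - 3\<close> only use
    \<open>4 * q \<le> k\<close>.\<close>
  have 3: "12 * k * (4 * q) ^ q \<le> k ^ q"
  proof -
    have k4: "4 * q \<le> k" using q4 k by linarith
    have "12 * k * (4 * q) ^ 3 = (768 * q ^ 3) * k" by (simp add: power_mult_distrib)
    also have "\<dots> \<le> (k * k) * k"
    proof (rule mult_right_mono)
      have "768 * q ^ 3 \<le> k" using q4 k by linarith
      also have "k \<le> k * k" using kq by simp
      finally show "768 * q ^ 3 \<le> k * k" .
    qed simp
    finally have "12 * k * (4 * q) ^ 3 \<le> k ^ 3" by (simp add: power3_eq_cube)
    then have "(12 * k * (4 * q) ^ 3) * (4 * q) ^ (q - 3) \<le> k ^ 3 * k ^ (q - 3)"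
      using k4 by (intro mult_mono power_mono) auto
    moreover have "z ^ 3 * z ^ (q - 3) = z ^ q" for z :: nat using q by (simp flip: power_add)
    ultimately show ?thesis by (simp only: mult.assoc)
  qed
  have pos: "m choose (4 * q) > 0" "(4 * q) ^ q > 0" "m choose (3 * q) > 0"
    using q kq by (auto simp: m_def)
  have "(12 * k * card \<C>) * ((m choose (4 * q)) * (4 * q) ^ q)
      = (12 * k * (4 * q) ^ q) * (card \<C> * (m choose (4 * q)))" by (simp only: mult_ac)
  also have "\<dots> \<le> k ^ q * (g * (m choose (3 * q)))" by (intro mult_mono 1 3) auto
  also have "\<dots> = g * ((m choose (3 * q)) * k ^ q)" by (simp only: mult_ac)
  also have "\<dots> \<le> g * ((m choose (4 * q)) * (4 * q) ^ q)" by (intro mult_left_mono 2) auto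
  finally show ?thesis using pos unfolding g_def by simp
qed

section \<open>Choice of \<open>k0\<close> and combination of the regimes\<close>

text \<open>The first condition turns \<open>q < 100 * ln k\<close> into the polynomial bound
  \<open>2048 * q ^ 4 \<le> k\<close>; the second is the error allowance of the containers.\<close>

lemma eventually_large_k:
  "eventually (\<lambda>k::nat. 2048 * (100 * ln (real k)) ^ 4 \<le> real k \<and>
     43 / real k + 2 * log 2 (real k) / sqrt (real k) \<le> 2 / 5) at_top"
proof (rule eventually_conj)
  show "eventually (\<lambda>k::nat. 2048 * (100 * ln (real k)) ^ 4 \<le> real k) at_top" by real_asymp
  have "((\<lambda>k::nat. 43 / real k + 2 * log 2 (real k) / sqrt (real k)) \<longlongrightarrow> 0) at_top"
    unfolding log_def by real_asymp
  then have "eventually (\<lambda>k::nat. 43 / real k + 2 * log 2 (real k) / sqrt (real k) < 2 / 5) at_top"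
    by (rule order_tendstoD) simp
  then show "eventually (\<lambda>k::nat. 43 / real k + 2 * log 2 (real k) / sqrt (real k) \<le> 2 / 5) at_top"
    by eventually_elim simp
qed

theorem claim5p3:
  shows "\<exists>k0::nat. \<forall>(k::nat) (q::nat) (n::nat) (x::nat) (a::nat) (g::nat).
    k \<ge> k0 \<longrightarrow> 3 \<le> q \<longrightarrow> real q < 100 * ln (real k) \<longrightarrow> n = 2 * k + q \<longrightarrow> x \<in> {1..n} \<longrightarrow>
    1 \<le> a \<longrightarrow> 1 \<le> g \<longrightarrow> a \<le> T0 n k q \<longrightarrow>
      (d_X k q \<le> g \<and> g \<le> d_X k q ^ 3 \<longrightarrow>
         real (card (G_family n k q x a g)) \<le> 2 powr (real g / 2)) \<and>
      (g > d_X k q ^ 3 \<longrightarrow>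
         real (card (G_family n k q x a g))
           \<le> 2 powr (real g * (1 - 1 / (real k * sqrt (real (d_X k q))))))"
proof -
  obtain k0 :: nat where k0: "\<And>k. k \<ge> k0 \<Longrightarrow> 2048 * (100 * ln (real k)) ^ 4 \<le> real k \<and>
     43 / real k + 2 * log 2 (real k) / sqrt (real k) \<le> 2 / 5"
    using eventually_large_k unfolding eventually_at_top_linorder by blast
  show ?thesis
  proof (intro exI[of _ k0] allI impI)
    fix k q n x a g :: nat
    assume kk0: "k \<ge> k0" and q: "3 \<le> q" and qln: "real q < 100 * ln (real k)"
      and n: "n = 2 * k + q" and x: "x \<in> {1..n}" and a1: "1 \<le> a" and g1: "1 \<le> g"
      and a: "a \<le> T0 n k q"
    have "real (2048 * q ^ 4) \<le> 2048 * (100 * ln (real k)) ^ 4"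
      using qln power_mono[of "real q" "100 * ln (real k)" 4] by simp
    also have "\<dots> \<le> real k" using k0[OF kk0] by simp
    finally have kq4: "2048 * q ^ 4 \<le> k" by (simp only: of_nat_le_iff)
    have asymp: "43 / real k + 2 * log 2 (real k) / sqrt (real k) \<le> 2 / 5" using k0[OF kk0] by simp
    have "3 ^ 4 \<le> q ^ 4" using q by (intro power_mono) auto
    then have k6400: "6400 \<le> k" using kq4 by simp
    have "q \<le> q ^ 4" using power_increasing[of 1 4 q] q by simp
    then have kq: "100 * q \<le> k" using kq4 by linarith
    define V where "V = {1..n} - {x}"
    have V: "finite V" "card V = 2 * k + q - 1" using x n by (auto simp: V_def)
    define X where "X = {A. A \<subseteq> V \<and> card A = k + q - 1}"
    have XX: "X_part n k q x = X" by (simp add: X_part_def X_def V_def)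
    define d where "d = d_X k q"
    have d: "real k ^ 3 / 6 \<le> real d"
      unfolding d_def d_X_def using q k6400 by (intro binomial_ge_cube) auto
    have "6400 * real k ^ 2 \<le> real k ^ 3"
      using k6400 mult_right_mono[of 6400 "real k" "real k ^ 2"] by (simp add: power2_eq_square power3_eq_cube)
    then have d2: "1000 * real k ^ 2 \<le> real d" using d zero_le_power2[of "real k"] by linarith
    have k2: "real k \<le> real k ^ 2" "1 \<le> real k" using k6400 by (simp_all add: power2_eq_square)
    have k1: "k \<ge> 1" "q \<ge> 1" using k6400 q by auto
    have fX: "finite X" using V(1) by (auto simp: X_def)
    have mem: "\<A> \<subseteq> X" "card \<A> \<le> a" "card (shadow (k - 1) \<A>) = g"
      "card (closure_X n k q x \<A>) = a" "closure_X n k q x \<A> \<subseteq> X"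
      "shadow (k - 1) (closure_X n k q x \<A>) = shadow (k - 1) \<A>"
      if "\<A> \<in> G_family n k q x a g" for \<A>
    proof -
      have A: "\<A> \<subseteq> X_part n k q x" "card (closure_X n k q x \<A>) = a" "card (nbhd n k q x \<A>) = g"
        using that by (auto simp: G_family_def)
      note cp = closure_props[OF k1 A(1)]
      show "\<A> \<subseteq> X" "card (closure_X n k q x \<A>) = a" "closure_X n k q x \<A> \<subseteq> X"
        "shadow (k - 1) (closure_X n k q x \<A>) = shadow (k - 1) \<A>"
        using A cp XX by auto
      show "card (shadow (k - 1) \<A>) = g" using A(3) nbhd_eq_shadow[OF k1 A(1)] by simp
      show "card \<A> \<le> a" unfolding A(2)[symmetric] using cp XX fX
        by (intro card_mono) (auto intro: finite_subset)
    qed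
    have sub_a: "G_family n k q x a g \<subseteq> {\<A>. \<A> \<subseteq> X \<and> card \<A> \<le> a}" using mem by blast
    have fin_a: "finite {\<A>. \<A> \<subseteq> X \<and> card \<A> \<le> a}" using fX by (auto intro: finite_subset[of _ "Pow X"])
    have small: "real (card (G_family n k q x a g)) \<le> 2 powr (real g / 2)"
      if dg: "d \<le> g" "g \<le> d ^ 3"
    proof (cases "G_family n k q x a g = {}")
      \<comment> \<open>The relation between \<open>a\<close> and \<open>g\<close> comes from the
        closure of a member of the family, so one has to exist.\<close>
      case False
      then obtain \<A> where A: "\<A> \<in> G_family n k q x a g" by auto
      have "12 * k * card (closure_X n k q x \<A>) \<le> card (shadow (k - 1) (closure_X n k q x \<A>))"
        using mem[OF A] dg(2) by (intro small_regime[OF V q kq4]) (auto simp: X_def d_def d_X_def)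
      then have ag: "12 * k * a \<le> g" using mem[OF A] by simp
      have "card X \<le> 2 ^ n"
      proof -
        have "card X = (n - 1) choose (k + q - 1)" using V by (simp add: X_def n_subsets n)
        also have "\<dots> \<le> 2 ^ (n - 1)" by (rule binomial_le_pow2)
        also have "\<dots> \<le> 2 ^ n" by (intro power_increasing) auto
        finally show ?thesis .
      qed
      then have cX: "real (card X) \<le> 2 ^ n" by (metis of_nat_le_iff of_nat_numeral of_nat_power)
      have "real (card (G_family n k q x a g)) \<le> real (card {\<A>. \<A> \<subseteq> X \<and> real (card \<A>) \<le> real a})"
        using card_mono[OF fin_a sub_a] by simp
      also have "\<dots> \<le> 2 powr (real n * real a + 2)"
        using fX cX by (rule card_small_subsets_pow2)
      also have "\<dots> \<le> 2 powr (real g / 2)"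
      proof (rule powr_mono)
        \<comment> \<open>\<open>n \<le> 3 * k\<close> gives \<open>n * a \<le> g / 4\<close>, and
          \<open>g \<ge> 8\<close> absorbs the additive \<open>2\<close>.\<close>
        have "4 * (n * a) \<le> 12 * k * a" using n kq by simp
        then have "real (4 * (n * a)) \<le> real g" using ag by (simp only: of_nat_le_iff)
        moreover have "8 \<le> real g" using d2 k2 dg(1) k6400 by linarith
        ultimately show "real n * real a + 2 \<le> real g / 2" by simp
      qed simp
      finally show ?thesis .
    qed simp
    have large: "real (card (G_family n k q x a g)) \<le> 2 powr (real g * (1 - 1 / (real k * sqrt (real d))))"
      if dg: "g > d ^ 3"
    proof -
      have "100 \<le> real d" using d2 k2 by linarith
      then have sd: "10 \<le> sqrt (real d)" by (intro real_le_rsqrt) auto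
      have dd: "d \<le> d ^ 3" by (cases "d = 0") (auto intro: self_le_power)
      have g2: "2 * real k ^ 2 \<le> real g" using d2 dd dg k2 by linarith
      \<comment> \<open>As \<open>sqrt d_X \<ge> 10\<close>, a saving of \<open>1 / (10 * k)\<close>
        is at least the required one.\<close>
      have "1 / (real k * sqrt (real d)) \<le> 1 / (real k * 10)"
        using sd k2 by (intro frac_le mult_left_mono) auto
      then have final: "2 powr (real g * (1 - 1 / (10 * real k)))
          \<le> 2 powr (real g * (1 - 1 / (real k * sqrt (real d))))"
        by (intro powr_mono mult_left_mono) (auto simp: mult.commute)
      have "real (card (G_family n k q x a g)) \<le> 2 powr (real g * (1 - 1 / (10 * real k)))"
      proof (cases "40 * real g \<le> real ((2 * k + q - 1) choose (k - 1))")
        case True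
        have "G_family n k q x a g \<subseteq> {\<A>. \<A> \<subseteq> X \<and> real (card (shadow (k - 1) \<A>)) \<le> real g}"
          using mem by auto
        moreover have "finite {\<A>. \<A> \<subseteq> X \<and> real (card (shadow (k - 1) \<A>)) \<le> real g}"
          using fX by (auto intro: finite_subset[of _ "Pow X"])
        ultimately have "real (card (G_family n k q x a g))
            \<le> real (card {\<A>. \<A> \<subseteq> X \<and> real (card (shadow (k - 1) \<A>)) \<le> real g})"
          by (simp add: card_mono)
        also have "\<dots> \<le> 2 powr (real g * (1 - 1 / (10 * real k)))"
          unfolding X_def using V q kq k6400 asymp g2 True by (intro container_regime) auto
        finally show ?thesis .
      next
        case False
        have "real (card (G_family n k q x a g)) \<le> real (card {\<A>. \<A> \<subseteq> X \<and> card \<A> \<le> a})"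
          using card_mono[OF fin_a sub_a] by simp
        also have "\<dots> \<le> 2 powr (real g * (9 / 10))"
          unfolding X_def using V k1 kq a False by (intro trivial_regime) (auto simp: T0_def n)
        also have "\<dots> \<le> 2 powr (real g * (1 - 1 / (10 * real k)))"
          using k2 by (intro powr_mono mult_left_mono) (auto simp: field_simps)
        finally show ?thesis .
      qed
      then show ?thesis using final by linarith
    qed
    show "(d_X k q \<le> g \<and> g \<le> d_X k q ^ 3 \<longrightarrow>
         real (card (G_family n k q x a g)) \<le> 2 powr (real g / 2)) \<and>
      (g > d_X k q ^ 3 \<longrightarrow>
         real (card (G_family n k q x a g))
           \<le> 2 powr (real g * (1 - 1 / (real k * sqrt (real (d_X k q))))))"
      using small large unfolding d_def by blast
  qed
qed

end
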